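(* Let $n$ be large and $B\ge\log n$ an integer. Consider a stream $((x_1,\Delta_1),\dots,(x_m,\Delta_m))$ with $x_j\in[n]$ and $\Delta_j>0$, whose final frequency vector is Zipfian: $\sum_{j:x_j=i}\Delta_j=f_i=1/i$ for all $i\in[n]$. Suppose a heavy-hitter oracle correctly reports, for any queried $i$, whether $i$ is one of the top $B/2$ heavy hitters (i.e., whether $i\le B/2$). Consider the following algorithm. Let $T=\Theta(\log\log n)$; maintain independent CountSketch tables $S_1,\dots,S_{T-1}$ with $4$ rows and $\frac{B}{16T}$ columns each, and $S_T$ with $4$ rows and $\frac{B}{16}$ columns. When $(x_j,\Delta_j)$ arrives: if $x_j$ has already been classified as a top $B/2$ heavy hitter, add $\Delta_j$ to its exact count (maintained from the time it was classified); otherwise, query the oracle on $x_j$ with probability $p_j=\min(1,\gamma B(\log n)^2\Delta_j)$ for a sufficiently large constant $\gamma$; if it is queried and is a top $B/2$ heavy hitter, classify it as such and start an exact count of it from this point on (including $\Delta_j$), and otherwise feed $(x_j,\Delta_j)$ into all $T$ tables. To answer a query for $i$: if $i$ has been classified as a heavy hitter, output its exact count; otherwise let $\hat f_i^{\,j}$ be the estimate of table $S_j$, $\tilde f_i=\mathrm{Median}(\hat f_i^{\,1},\dots,\hat f_i^{\,T-1})$, and output $\hat f_i=0$ if $\tilde f_i<\tau$ with $\tau=\Theta(\log\log n)/B$, and $\hat f_i=\hat f_i^{\,T}$ otherwise. Then, for suitable absolute constants in $T$ and $\tau$, $$\mathbb{E}\left[\frac{1}{N}\sum_{i=1}^n f_i\,|f_i-\hat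 f_i|\right]=O\left(\frac{1}{B\log n}\right),$$ where $N=\sum_i f_i$, and the algorithm makes $O(B(\log n)^3)$ queries to the heavy-hitter oracle in expectation.
   Context: A CountSketch table with $k$ rows and $w$ columns uses independent uniformly random hash functions $h_1,\dots,h_k:[n]\to[w]$ and signs $s_1,\dots,s_k:[n]\to\{-1,1\}$, maintains $C[\ell,b]=\sum_j[h_\ell(j)=b]s_\ell(j)g_j$ where $g$ is the vector of updates fed to the table, and estimates coordinate $i$ by $\mathrm{median}_{\ell\in[k]}s_\ell(i)C[\ell,h_\ell(i)]$ (for an even number of rows, any fixed median convention). Expectations are over the randomness of the tables and of the sampling of oracle queries. *)

theory Defs
  imports "HOL-Probability.Probability"
begin

text \<open>
  A stream is a list of updates (x, \<Delta>); items are the naturals 1, ..., n. All logarithms are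
  natural.
\<close>

definition freq :: "(nat \<times> real) list \<Rightarrow> nat \<Rightarrow> real" where
  "freq \<sigma> i = (\<Sum>(x, \<Delta>)\<leftarrow>filter (\<lambda>u. fst u = i) \<sigma>. \<Delta>)"

definition zipf_stream :: "nat \<Rightarrow> (nat \<times> real) list \<Rightarrow> bool" where
  "zipf_stream n \<sigma> \<longleftrightarrow>
     (\<forall>(x, \<Delta>)\<in>set \<sigma>. x \<in> {1..n} \<and> \<Delta> > 0) \<and> (\<forall>i\<in>{1..n}. freq \<sigma> i = 1 / real i)"

definition correct_oracle :: "nat \<Rightarrow> nat \<Rightarrow> (nat \<Rightarrow> bool) \<Rightarrow> bool" where
  "correct_oracle n B oracle \<longleftrightarrow> (\<forall>i\<in>{1..n}. oracle i \<longleftrightarrow> real i \<le> real B / 2)"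

text \<open>
  The two bounds coincide for lists of odd length; for even length they are the two middle order
  statistics, between which a convention may choose freely.
\<close>

definition median_convention :: "(real list \<Rightarrow> real) \<Rightarrow> bool" where
  "median_convention med \<longleftrightarrow>
     (\<forall>xs. xs \<noteq> [] \<longrightarrow>
        sort xs ! ((length xs - 1) div 2) \<le> med xs \<and> med xs \<le> sort xs ! (length xs div 2))"

text \<open>The randomness of a CountSketch table: row l is mapped to its hash function and its signs.\<close>

type_synonym cs_table = "nat \<Rightarrow> (nat \<Rightarrow> nat) \<times> (nat \<Rightarrow> real)"

definition cs_table_pmf :: "nat \<Rightarrow> nat \<Rightarrow> nat \<Rightarrow> cs_table pmf" where
  "cs_table_pmf n k w =
     Pi_pmf {1..k} undefined
       (\<lambda>_. pair_pmf (pmf_of_set ({1..n} \<rightarrow>\<^sub>E {1..w})) (pmf_of_set ({1..n} \<rightarrow>\<^sub>E {-1, 1})))"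

definition cs_counter :: "nat \<Rightarrow> cs_table \<Rightarrow> (nat \<Rightarrow> real) \<Rightarrow> nat \<Rightarrow> nat \<Rightarrow> real" where
  "cs_counter n S g l b = (\<Sum>j=1..n. of_bool (fst (S l) j = b) * snd (S l) j * g j)"

definition cs_estimate ::
    "(real list \<Rightarrow> real) \<Rightarrow> nat \<Rightarrow> nat \<Rightarrow> cs_table \<Rightarrow> (nat \<Rightarrow> real) \<Rightarrow> nat \<Rightarrow> real" where
  "cs_estimate med n k S g i =
     med (map (\<lambda>l. snd (S l) i * cs_counter n S g l (fst (S l) i)) [1..<Suc k])"

text \<open>
  An item x is classified iff \<open>exact x \<noteq> None\<close>. All tables receive the same updates, so one vector
  \<open>fed\<close> records what has been fed to each of them. \<open>queries\<close> counts the oracle calls.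
\<close>

record alg_state =
  exact :: "nat \<Rightarrow> real option"
  fed :: "nat \<Rightarrow> real"
  queries :: nat

definition init_state :: alg_state where
  "init_state = \<lparr>exact = Map.empty, fed = (\<lambda>_. 0), queries = 0\<rparr>"

definition process_update ::
    "real \<Rightarrow> nat \<Rightarrow> nat \<Rightarrow> (nat \<Rightarrow> bool) \<Rightarrow> nat \<times> real \<Rightarrow> alg_state \<Rightarrow> alg_state pmf" where
  "process_update \<gamma> n B oracle = (\<lambda>(x, \<Delta>) st.
     (case exact st x of
        Some c \<Rightarrow> return_pmf (st\<lparr>exact := (exact st)(x \<mapsto> c + \<Delta>)\<rparr>)
      | None \<Rightarrow> do {
          queried \<leftarrow> bernoulli_pmf (min 1 (\<gamma> * real B * (ln (real n))\<^sup>2 * \<Delta>));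
          let st' = st\<lparr>queries := queries st + of_bool queried\<rparr>;
          return_pmf
            (if queried \<and> oracle x
             then st'\<lparr>exact := (exact st')(x \<mapsto> \<Delta>)\<rparr>
             else st'\<lparr>fed := (fed st')(x := fed st' x + \<Delta>)\<rparr>)
        }))"

primrec process_stream ::
    "real \<Rightarrow> nat \<Rightarrow> nat \<Rightarrow> (nat \<Rightarrow> bool) \<Rightarrow> (nat \<times> real) list \<Rightarrow> alg_state \<Rightarrow> alg_state pmf" where
  "process_stream \<gamma> n B oracle [] st = return_pmf st"
| "process_stream \<gamma> n B oracle (u # us) st =
     process_update \<gamma> n B oracle u st \<bind> process_stream \<gamma> n B oracle us"

definition tables_pmf :: "nat \<Rightarrow> nat \<Rightarrow> nat \<Rightarrow> (nat \<Rightarrow> cs_table) pmf" where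
  "tables_pmf n B T =
     Pi_pmf {1..T} undefined
       (\<lambda>t. cs_table_pmf n 4 (if t < T then B div (16 * T) else B div 16))"

definition alg_pmf ::
    "real \<Rightarrow> nat \<Rightarrow> nat \<Rightarrow> nat \<Rightarrow> (nat \<Rightarrow> bool) \<Rightarrow> (nat \<times> real) list \<Rightarrow>
       (alg_state \<times> (nat \<Rightarrow> cs_table)) pmf" where
  "alg_pmf \<gamma> n B T oracle \<sigma> =
     pair_pmf (process_stream \<gamma> n B oracle \<sigma> init_state) (tables_pmf n B T)"

definition answer ::
    "(real list \<Rightarrow> real) \<Rightarrow> nat \<Rightarrow> nat \<Rightarrow> real \<Rightarrow> alg_state \<times> (nat \<Rightarrow> cs_table) \<Rightarrow> nat \<Rightarrow> real" where
  "answer med n T \<tau> = (\<lambda>(st, S) i.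
     (case exact st i of
        Some c \<Rightarrow> c
      | None \<Rightarrow>
          if med (map (\<lambda>t. cs_estimate med n 4 (S t) (fed st) i) [1..<T]) < \<tau> then 0
          else cs_estimate med n 4 (S T) (fed st) i))"

definition weighted_error :: "nat \<Rightarrow> (nat \<Rightarrow> real) \<Rightarrow> (nat \<Rightarrow> real) \<Rightarrow> real" where
  "weighted_error n f f' = 1 / (\<Sum>i=1..n. f i) * (\<Sum>i=1..n. f i * \<bar>f i - f' i\<bar>)"

end

theory Submission
  imports Defs
begin

text \<open>
  Let \<open>\<lambda> = \<gamma> B (ln n)\<^sup>2\<close> be the query rate per unit of mass. For a heavy item, the mass fed to the
  tables before its classification has first and second moments at most \<open>1/\<lambda>\<close> and \<open>2/\<lambda>\<^sup>2\<close>, and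
  \<open>exp (\<lambda> \<cdot> fed)\<close> restricted to non-classification has expectation at most 1; each of these bounds
  comes from a supermartingale along the stream. A row of width \<open>w\<close> has noise of second moment at most
  \<open>V/w\<close>, where \<open>V\<close> is the squared norm of the fed vector: \<open>4/B\<close> from the light items plus the residual
  \<open>H\<close> of the heavy ones. If \<open>H \<le> 1/B\<close>, a table reaches \<open>\<tau>\<close> on a light item with small constant
  probability, so the median of \<open>T - 1\<close> tables does so with probability at most \<open>1/ln n\<close>, and the
  independent last table then errs by \<open>O(1/B)\<close>. If \<open>H > 1/B\<close>, the error is \<open>O(H)\<close>, and \<open>E H\<close> is
  negligible. The light items that are answered by 0 contribute \<open>(1/N) \<Sum>\<^bsub>i>B/2\<^esub> 1/i\<^sup>2 = O(1/(B ln n))\<close>.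
\<close>

subsection \<open>Expectations over finitely supported distributions\<close>

text \<open>Tower rule. Finite support makes every real function integrable, and all distributions
  below have finite support.\<close>

lemma expectation_bind_pmf_finite:
  fixes h :: "'b \<Rightarrow> real"
  assumes "finite (set_pmf p)" "\<And>x. x \<in> set_pmf p \<Longrightarrow> finite (set_pmf (f x))"
  shows "measure_pmf.expectation (p \<bind> f) h =
           measure_pmf.expectation p (\<lambda>x. measure_pmf.expectation (f x) h)"
  using assms
  by (subst pmf_expectation_bind[of "set_pmf p"])
     (auto simp: integral_measure_pmf[where A = "set_pmf p"])

lemma expectation_pair_pmf_finite:
  fixes h :: "'a \<times> 'b \<Rightarrow> real"
  assumes "finite (set_pmf p)" "finite (set_pmf q)"
  shows "measure_pmf.expectation (pair_pmf p q) h =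
           measure_pmf.expectation p (\<lambda>x. measure_pmf.expectation q (\<lambda>y. h (x, y)))"
  using assms unfolding pair_pmf_def
  by (simp add: expectation_bind_pmf_finite)

lemma expectation_mono_finite:
  fixes f g :: "'a \<Rightarrow> real"
  assumes "finite (set_pmf p)" "\<And>x. x \<in> set_pmf p \<Longrightarrow> f x \<le> g x"
  shows "measure_pmf.expectation p f \<le> measure_pmf.expectation p g"
  using assms
  by (intro integral_mono_AE) (auto intro: integrable_measure_pmf_finite AE_pmfI)

lemma expectation_le_const_finite:
  fixes f :: "'a \<Rightarrow> real"
  assumes "finite (set_pmf p)" "\<And>x. x \<in> set_pmf p \<Longrightarrow> f x \<le> c"
  shows "measure_pmf.expectation p f \<le> c"
  using expectation_mono_finite[OF assms] by simp

lemma finite_set_Pi_pmf: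
  assumes "finite A" "\<And>x. x \<in> A \<Longrightarrow> finite (set_pmf (p x))"
  shows "finite (set_pmf (Pi_pmf A d p))"
  using assms by (auto simp: set_Pi_pmf intro!: finite_PiE_dflt)

lemma expectation_Pi_pmf_component:
  fixes f :: "'b \<Rightarrow> real"
  assumes "finite A" "x \<in> A"
  shows "measure_pmf.expectation (Pi_pmf A d p) (\<lambda>y. f (y x)) = measure_pmf.expectation (p x) f"
  using Pi_pmf_component[of A x d p] assms by (metis integral_map_pmf)

subsection \<open>Sampling of oracle queries\<close>

definition classify :: "nat \<times> real \<Rightarrow> alg_state \<Rightarrow> alg_state" where
  "classify = (\<lambda>(x, \<Delta>) st.
     st\<lparr>queries := queries st + 1, exact := (exact st)(x \<mapsto> \<Delta>)\<rparr>)"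

text \<open>\<open>q\<close> counts the oracle calls made by the update: 1 for a queried item that
  the oracle rejects, 0 for an item that is not queried.\<close>

definition feed :: "nat \<Rightarrow> nat \<times> real \<Rightarrow> alg_state \<Rightarrow> alg_state" where
  "feed q = (\<lambda>(x, \<Delta>) st.
     st\<lparr>queries := queries st + q, fed := (fed st)(x := fed st x + \<Delta>)\<rparr>)"

definition count_exactly :: "nat \<times> real \<Rightarrow> alg_state \<Rightarrow> alg_state" where
  "count_exactly = (\<lambda>(x, \<Delta>) st.
     st\<lparr>exact := (exact st)(x \<mapsto> the (exact st x) + \<Delta>)\<rparr>)"

definition query_rate :: "real \<Rightarrow> nat \<Rightarrow> nat \<Rightarrow> real" where
  "query_rate \<gamma> n B = \<gamma> * real B * (ln (real n))\<^sup>2"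

lemmas step_defs = classify_def feed_def count_exactly_def

context
  fixes \<gamma> :: real and n B :: nat and orc :: "nat \<Rightarrow> bool"
begin

abbreviation qrate :: real where
  "qrate \<equiv> query_rate \<gamma> n B"

lemma process_update_eq:
  "process_update \<gamma> n B orc u st =
     (if exact st (fst u) \<noteq> None then return_pmf (count_exactly u st)
      else map_pmf (\<lambda>q. if q \<and> orc (fst u) then classify u st else feed (of_bool q) u st)
             (bernoulli_pmf (min 1 (qrate * snd u))))"
  by (cases u; cases "exact st (fst u)")
     (auto simp: process_update_def step_defs query_rate_def map_pmf_def Let_def intro!: bind_pmf_cong)

lemma finite_process_update: "finite (set_pmf (process_update \<gamma> n B orc u st))"
  by (auto simp: process_update_eq)

lemma finite_process_stream: "finite (set_pmf (process_stream \<gamma> n B orc us st))"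
  by (induction us arbitrary: st) (auto simp: finite_process_update)

lemma expectation_process_update:
  fixes \<phi> :: "alg_state \<Rightarrow> real"
  assumes "\<gamma> \<ge> 0" "snd u > 0"
  defines "p \<equiv> min 1 (qrate * snd u)"
  shows "measure_pmf.expectation (process_update \<gamma> n B orc u st) \<phi> =
     (if exact st (fst u) \<noteq> None then \<phi> (count_exactly u st)
      else p * \<phi> (if orc (fst u) then classify u st else feed 1 u st) + (1 - p) * \<phi> (feed 0 u st))"
proof -
  have "0 \<le> p" "p \<le> 1"
    using assms by (auto simp: query_rate_def)
  then show ?thesis
    by (auto simp: process_update_eq simp flip: p_def)
qed

text \<open>Additive drift: induction along the stream accumulates the one-step increments of a
  potential \<open>\<phi>\<close>, where the drift has to be checked only on states satisfying the
  invariant \<open>I\<close>. With \<open>c = 0\<close> this is the supermartingale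
  inequality.\<close>

lemma expectation_process_stream_le:
  fixes \<phi> :: "alg_state \<Rightarrow> real" and c :: "nat \<times> real \<Rightarrow> real"
  assumes inv: "\<And>u st st'. u \<in> set us \<Longrightarrow> I st \<Longrightarrow>
      st' \<in> set_pmf (process_update \<gamma> n B orc u st) \<Longrightarrow> I st'"
    and drift: "\<And>u st. u \<in> set us \<Longrightarrow> I st \<Longrightarrow>
      measure_pmf.expectation (process_update \<gamma> n B orc u st) \<phi> \<le> \<phi> st + c u"
    and "I st"
  shows "measure_pmf.expectation (process_stream \<gamma> n B orc us st) \<phi>
    \<le> \<phi> st + sum_list (map c us)"
  using assms
proof (induction us arbitrary: st)
  case (Cons u us)
  let ?P = "process_update \<gamma> n B orc u st"
  have "measure_pmf.expectation (process_stream \<gamma> n B orc (u # us) st) \<phi> =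
      measure_pmf.expectation ?P
        (\<lambda>st'. measure_pmf.expectation (process_stream \<gamma> n B orc us st') \<phi>)"
    by (simp add: expectation_bind_pmf_finite finite_process_stream finite_process_update)
  also have "\<dots> \<le> measure_pmf.expectation ?P (\<lambda>st'. \<phi> st' + sum_list (map c us))"
  proof (rule expectation_mono_finite[OF finite_process_update])
    fix st' assume "st' \<in> set_pmf ?P"
    then have "I st'"
      using Cons.prems by (metis list.set_intros(1))
    then show "measure_pmf.expectation (process_stream \<gamma> n B orc us st') \<phi>
        \<le> \<phi> st' + sum_list (map c us)"
      using Cons.prems by (intro Cons.IH) auto
  qed
  also have "\<dots> = measure_pmf.expectation ?P \<phi> + sum_list (map c us)"
    by (simp add: integrable_measure_pmf_finite finite_process_update)
  also have "\<dots> \<le> \<phi> st + c u + sum_list (map c us)"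
    using Cons.prems(2)[of u st] Cons.prems(3) by simp
  finally show ?case by simp
qed simp

section \<open>Conservation of mass and the shape of final states\<close>

definition valid_state :: "alg_state \<Rightarrow> bool" where
  "valid_state st \<longleftrightarrow> (\<forall>x. fed st x \<ge> 0) \<and> (\<forall>x c. exact st x = Some c \<longrightarrow> c \<ge> 0 \<and> orc x)"

text \<open>A conserved quantity: whichever branch an update takes, its weight lands either in
  \<open>fed\<close> or in the exact count, and weight fed before a classification stays in
  \<open>fed\<close>. The final mass of an item is therefore its frequency.\<close>

definition mass :: "alg_state \<Rightarrow> nat \<Rightarrow> real" where
  "mass st x = fed st x + (case exact st x of None \<Rightarrow> 0 | Some c \<Rightarrow> c)"

lemma valid_state_init: "valid_state init_state"
  by (simp add: valid_state_def init_state_def)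

lemma mass_init: "mass init_state x = 0"
  by (simp add: mass_def init_state_def)

lemma process_update_valid:
  assumes "st' \<in> set_pmf (process_update \<gamma> n B orc u st)" "valid_state st" "snd u > 0"
  shows "valid_state st'"
  using assms
  by (auto simp: process_update_eq valid_state_def step_defs case_prod_unfold split: if_splits)

lemma process_update_mass:
  assumes "st' \<in> set_pmf (process_update \<gamma> n B orc u st)"
  shows "mass st' x = mass st x + (if fst u = x then snd u else 0)"
  using assms
  by (auto simp: process_update_eq mass_def step_defs case_prod_unfold split: if_splits)

lemma process_stream_invariant:
  assumes "st' \<in> set_pmf (process_stream \<gamma> n B orc us st)" "valid_state st"
    and "\<And>u. u \<in> set us \<Longrightarrow> snd u > 0"
  shows "valid_state st' \<and> (\<forall>x. mass st' x = mass st x + freq us x)"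
  using assms
proof (induction us arbitrary: st)
  case (Cons u us)
  from Cons.prems obtain st1 where st1: "st1 \<in> set_pmf (process_update \<gamma> n B orc u st)"
    "st' \<in> set_pmf (process_stream \<gamma> n B orc us st1)"
    by auto
  have "valid_state st1"
    using process_update_valid[OF st1(1)] Cons.prems by simp
  from Cons.IH[OF st1(2) this] Cons.prems
  show ?case
    using process_update_mass[OF st1(1)] by (auto simp: freq_def case_prod_unfold)
qed (simp add: freq_def)

text \<open>By conservation of mass, an exact count misses precisely what was fed before the
  classification, and an unclassified item has been fed entirely.\<close>

lemma final_state_cases:
  assumes st: "st \<in> set_pmf (process_stream \<gamma> n B orc \<sigma> init_state)"
    and pos: "\<And>u. u \<in> set \<sigma> \<Longrightarrow> snd u > 0"
  shows "0 \<le> fed st x" "fed st x \<le> freq \<sigma> x"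
    and "exact st x = None \<Longrightarrow> fed st x = freq \<sigma> x"
    and "exact st x = Some c \<Longrightarrow> orc x \<and> freq \<sigma> x - c = fed st x"
proof -
  have *: "valid_state st" "mass st x = freq \<sigma> x"
    using process_stream_invariant[OF st valid_state_init pos] by (auto simp: mass_init)
  show "0 \<le> fed st x" "fed st x \<le> freq \<sigma> x"
    "exact st x = None \<Longrightarrow> fed st x = freq \<sigma> x"
    "exact st x = Some c \<Longrightarrow> orc x \<and> freq \<sigma> x - c = fed st x"
    using * by (auto simp: valid_state_def mass_def split: option.splits)
      (smt (verit))
qed

section \<open>Supermartingale bounds along the stream\<close>

context
  fixes \<sigma> :: "(nat \<times> real) list" and P :: "alg_state pmf"
  assumes rate_pos: "\<gamma> \<ge> 0" "qrate > 0"
    and pos: "\<And>u. u \<in> set \<sigma> \<Longrightarrow> snd u > 0"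
  defines "P \<equiv> process_stream \<gamma> n B orc \<sigma> init_state"
begin

lemma expectation_stream_supermartingale:
  fixes \<phi> :: "alg_state \<Rightarrow> real" and c :: "nat \<times> real \<Rightarrow> real"
  assumes "\<And>u st. u \<in> set \<sigma> \<Longrightarrow> valid_state st \<Longrightarrow>
      measure_pmf.expectation (process_update \<gamma> n B orc u st) \<phi> \<le> \<phi> st + c u"
  shows "measure_pmf.expectation P \<phi> \<le> \<phi> init_state + sum_list (map c \<sigma>)"
  unfolding P_def
  by (rule expectation_process_stream_le[where I = valid_state])
     (use assms process_update_valid pos valid_state_init in blast)+

lemma expectation_queries_le:
  "measure_pmf.expectation P (\<lambda>st. real (queries st)) \<le> qrate * (\<Sum>u\<leftarrow>\<sigma>. snd u)"
proof -
  have "measure_pmf.expectation P (\<lambda>st. real (queries st)) \<le>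
      real (queries init_state) + (\<Sum>u\<leftarrow>\<sigma>. qrate * snd u)"
  proof (rule expectation_stream_supermartingale)
    fix u st assume u: "u \<in> set \<sigma>"
    have "min 1 (qrate * snd u) \<le> qrate * snd u" by simp
    then show "measure_pmf.expectation (process_update \<gamma> n B orc u st) (\<lambda>st. real (queries st))
        \<le> real (queries st) + qrate * snd u"
      using pos[OF u] rate_pos
      by (subst expectation_process_update)
         (auto simp: step_defs case_prod_unfold algebra_simps)
  qed
  then show ?thesis
    by (simp add: init_state_def sum_list_const_mult)
qed

context
  fixes x :: nat
  assumes heavy: "orc x"
begin

lemma expectation_fed_le: "measure_pmf.expectation P (\<lambda>st. fed st x) \<le> 1 / qrate"
proof -
  \<comment> \<open>While \<open>x\<close> is unclassified, the mass still to be fed is charged as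
    the mean \<open>1 / qrate\<close> of an exponential waiting time, which does not depend on what
    was fed so far.\<close>
  let ?\<phi> = "\<lambda>st. fed st x + of_bool (exact st x = None) / qrate"
  have "measure_pmf.expectation P (\<lambda>st. fed st x) \<le> measure_pmf.expectation P ?\<phi>"
    using rate_pos by (intro expectation_mono_finite) (auto simp: P_def finite_process_stream)
  also have "\<dots> \<le> ?\<phi> init_state + (\<Sum>u\<leftarrow>\<sigma>. 0)"
  proof (rule expectation_stream_supermartingale)
    fix u st assume u: "u \<in> set \<sigma>"
    define p where "p = min 1 (qrate * snd u)"
    \<comment> \<open>If \<open>qrate * snd u\<close> reaches 1, the query is certain and the left
      side vanishes. Otherwise \<open>snd u = p / qrate\<close>, and the left side is
      \<open>(1 - p * p) / qrate\<close>.\<close>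
    have "(1 - p) * (snd u + 1 / qrate) \<le> 1 / qrate"
    proof (cases "qrate * snd u \<ge> 1")
      case True
      then show ?thesis using rate_pos by (simp add: p_def)
    next
      case False
      then have p: "p = qrate * snd u" by (simp add: p_def)
      then have "snd u = p / qrate" using rate_pos by simp
      then have "(1 - p) * (snd u + 1 / qrate) = (1 - p * p) / qrate"
        by (simp add: algebra_simps flip: add_divide_distrib)
      also have "\<dots> \<le> 1 / qrate"
        using rate_pos by (intro divide_right_mono) auto
      finally show ?thesis .
    qed
    then have key: "p * a + (1 - p) * (a + snd u + 1 / qrate) \<le> a + 1 / qrate" for a
      by (simp add: algebra_simps)
    show "measure_pmf.expectation (process_update \<gamma> n B orc u st) ?\<phi> \<le> ?\<phi> st + 0"
    proof (cases "fst u = x \<and> exact st x = None")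
      case True
      then show ?thesis
        using key pos[OF u] rate_pos heavy
        by (subst expectation_process_update)
           (simp_all add: step_defs case_prod_unfold flip: p_def)
    next
      case False
      then show ?thesis
        using pos[OF u] rate_pos heavy
        by (subst expectation_process_update)
           (auto simp: step_defs case_prod_unfold simp flip: p_def distrib_right)
    qed
  qed
  finally show ?thesis by (simp add: init_state_def)
qed

text \<open>The potential of an unclassified item with fed mass \<open>a\<close> is the second
  moment of \<open>a + X\<close> for \<open>X\<close> exponential of rate \<open>qrate\<close>,
  namely \<open>a\<^sup>2 + 2 * a / qrate + 2 / qrate\<^sup>2\<close>. After classification it is
  frozen at \<open>a\<^sup>2\<close>.\<close>

lemma expectation_fed_sq_le: "measure_pmf.expectation P (\<lambda>st. (fed st x)\<^sup>2) \<le> 2 / qrate\<^sup>2"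
proof -
  let ?\<phi> = "\<lambda>st. (fed st x)\<^sup>2 +
    of_bool (exact st x = None) * (2 * fed st x / qrate + 2 / qrate\<^sup>2)"
  have "measure_pmf.expectation P (\<lambda>st. (fed st x)\<^sup>2) \<le> measure_pmf.expectation P ?\<phi>"
    using rate_pos final_state_cases(1)[OF _ pos]
    by (intro expectation_mono_finite) (auto simp: P_def finite_process_stream)
  also have "\<dots> \<le> ?\<phi> init_state + (\<Sum>u\<leftarrow>\<sigma>. 0)"
  proof (rule expectation_stream_supermartingale)
    fix u st assume u: "u \<in> set \<sigma>" and valid: "valid_state st"
    define p where "p = min 1 (qrate * snd u)"
    define a where "a = fed st x"
    have a: "a \<ge> 0" using valid by (simp add: a_def valid_state_def)
    have key: "(1 - p) * ((a + snd u)\<^sup>2 + (2 * (a + snd u) / qrate + 2 / qrate\<^sup>2)) + p * a\<^sup>2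
        \<le> a\<^sup>2 + (2 * a / qrate + 2 / qrate\<^sup>2)"
    proof (cases "qrate * snd u \<ge> 1")
      case True
      then show ?thesis using rate_pos a by (simp add: p_def)
    next
      case False
      then have p: "p = qrate * snd u" by (simp add: p_def)
      then have p0: "p \<ge> 0" using rate_pos pos[OF u] by simp
      define r where "r = 1 / qrate"
      have r: "r > 0" using rate_pos by (simp add: r_def)
      have du: "snd u = p * r" using rate_pos p by (simp add: r_def)
      \<comment> \<open>With \<open>snd u = p * r\<close> the one-step change is an explicit
        polynomial, and the subtracted part is nonnegative.\<close>
      have "(1 - p) * ((a + p * r)\<^sup>2 + (2 * (a + p * r) * r + 2 * r\<^sup>2)) + p * a\<^sup>2
         = a\<^sup>2 + (2 * a * r + 2 * r\<^sup>2) - (2 * a * r * p\<^sup>2 + r\<^sup>2 * (p\<^sup>2 + p ^ 3))"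
        by (simp add: algebra_simps power2_eq_square power3_eq_cube)
      also have "\<dots> \<le> a\<^sup>2 + (2 * a * r + 2 * r\<^sup>2)"
      proof -
        have "0 \<le> 2 * a * r * p\<^sup>2 + r\<^sup>2 * (p\<^sup>2 + p ^ 3)"
          using a r p0 by (intro add_nonneg_nonneg mult_nonneg_nonneg) auto
        then show ?thesis by linarith
      qed
      finally show ?thesis
        unfolding du by (simp add: r_def power_divide)
    qed
    show "measure_pmf.expectation (process_update \<gamma> n B orc u st) ?\<phi> \<le> ?\<phi> st + 0"
    proof (cases "fst u = x \<and> exact st x = None")
      case True
      then show ?thesis
        using key pos[OF u] rate_pos heavy
        by (subst expectation_process_update)
           (simp_all add: step_defs case_prod_unfold flip: p_def a_def)
    next
      case False
      then show ?thesis
        using pos[OF u] rate_pos heavy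
        by (subst expectation_process_update)
           (auto simp: step_defs case_prod_unfold simp flip: p_def distrib_right)
    qed
  qed
  finally show ?thesis by (simp add: init_state_def)
qed

text \<open>An item that is unclassified at the end has been fed its whole frequency, so the
  potential then equals \<open>exp (qrate * freq \<sigma> x)\<close>. The potential starts at 1 and
  does not grow in expectation, since an update survives unqueried with probability
  \<open>1 - p\<close>, and \<open>(1 - p) * exp (qrate * snd u) \<le> 1\<close>.\<close>

lemma prob_unclassified_le:
  "measure_pmf.expectation P (\<lambda>st. of_bool (exact st x = None)) \<le> exp (- qrate * freq \<sigma> x)"
proof -
  let ?\<phi> = "\<lambda>st. of_bool (exact st x = None) * exp (qrate * fed st x)"
  have "measure_pmf.expectation P (\<lambda>st. of_bool (exact st x = None)) * exp (qrate * freq \<sigma> x) =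
      measure_pmf.expectation P (\<lambda>st. of_bool (exact st x = None) * exp (qrate * freq \<sigma> x))"
    by simp
  also have "\<dots> \<le> measure_pmf.expectation P ?\<phi>"
    using final_state_cases(3)[OF _ pos]
    by (intro expectation_mono_finite) (auto simp: P_def finite_process_stream)
  also have "\<dots> \<le> ?\<phi> init_state + (\<Sum>u\<leftarrow>\<sigma>. 0)"
  proof (rule expectation_stream_supermartingale)
    fix u st assume u: "u \<in> set \<sigma>"
    define p where "p = min 1 (qrate * snd u)"
    have "1 - p \<le> exp (- (qrate * snd u))"
      using exp_ge_add_one_self[of "- (qrate * snd u)"] by (auto simp: p_def min_def)
    then have "(1 - p) * exp (qrate * snd u) \<le> exp (- (qrate * snd u)) * exp (qrate * snd u)"
      by (intro mult_right_mono) auto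
    then have le1: "(1 - p) * exp (qrate * snd u) \<le> 1"
      by (simp flip: exp_add)
    have key: "(1 - p) * exp (qrate * (a + snd u)) \<le> exp (qrate * a)" for a
    proof -
      have "(1 - p) * exp (qrate * (a + snd u)) = exp (qrate * a) * ((1 - p) * exp (qrate * snd u))"
        by (simp add: distrib_left exp_add)
      also have "\<dots> \<le> exp (qrate * a) * 1"
        by (intro mult_left_mono le1) simp
      finally show ?thesis by simp
    qed
    show "measure_pmf.expectation (process_update \<gamma> n B orc u st) ?\<phi> \<le> ?\<phi> st + 0"
    proof (cases "fst u = x \<and> exact st x = None")
      case True
      then show ?thesis
        using key pos[OF u] rate_pos heavy
        by (subst expectation_process_update)
           (simp_all add: step_defs case_prod_unfold flip: p_def)
    next
      case False
      then show ?thesis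
        using pos[OF u] rate_pos heavy
        by (subst expectation_process_update)
           (auto simp: step_defs case_prod_unfold simp flip: p_def distrib_right)
    qed
  qed
  finally show ?thesis
    by (simp add: init_state_def exp_minus field_simps)
qed

end
end
end

subsection \<open>CountSketch tables\<close>

definition row_pmf :: "nat \<Rightarrow> nat \<Rightarrow> ((nat \<Rightarrow> nat) \<times> (nat \<Rightarrow> real)) pmf" where
  "row_pmf n w =
     pair_pmf (pmf_of_set ({1..n} \<rightarrow>\<^sub>E {1..w})) (pmf_of_set ({1..n} \<rightarrow>\<^sub>E {-1, 1}))"

definition row_noise :: "nat \<Rightarrow> (nat \<Rightarrow> real) \<Rightarrow> nat \<Rightarrow> (nat \<Rightarrow> nat) \<times> (nat \<Rightarrow> real) \<Rightarrow> real" where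
  "row_noise n g i = (\<lambda>(h, s). s i * (\<Sum>j=1..n. of_bool (h j = h i) * s j * g j) - g i)"

lemma cs_table_pmf_eq: "cs_table_pmf n k w = Pi_pmf {1..k} undefined (\<lambda>_. row_pmf n w)"
  by (simp add: cs_table_pmf_def row_pmf_def)

lemma expectation_sign_product:
  assumes "finite A" "j \<in> A" "k \<in> A"
  shows "measure_pmf.expectation (pmf_of_set (A \<rightarrow>\<^sub>E {-1, 1 :: real})) (\<lambda>s. s j * s k) = of_bool (j = k)"
proof -
  let ?S = "A \<rightarrow>\<^sub>E {-1, 1 :: real}"
  have S: "finite ?S" "?S \<noteq> {}"
    using assms by (auto simp: PiE_eq_empty_iff intro!: finite_PiE)
  show ?thesis
  proof (cases "j = k")
    case True
    have "(\<Sum>s\<in>?S. s k * s k) = (\<Sum>s\<in>?S. 1)"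
      using assms by (intro sum.cong) (auto simp: PiE_iff)
    then show ?thesis
      using S True by (simp add: integral_pmf_of_set)
  next
    case False
    \<comment> \<open>Flipping the sign of \<open>j\<close> is an involution of the sign vectors\<close>
    have "(\<Sum>s\<in>?S. s j * s k) = (\<Sum>s\<in>?S. - (s j * s k))"
      using assms False
      by (intro sum.reindex_bij_witness[where i = "\<lambda>s. s(j := - s j)" and j = "\<lambda>s. s(j := - s j)"])
         (auto simp: PiE_iff extensional_def)
    then have "(\<Sum>s\<in>?S. s j * s k) = 0"
      by (simp add: sum_negf)
    then show ?thesis
      using S False by (simp add: integral_pmf_of_set)
  qed
qed

text \<open>In a colliding hash function the value at \<open>j\<close> is forced by the value at
  \<open>i\<close>. Erasing it is a bijection onto the hash functions on \<open>A - {j}\<close>, so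
  a fraction \<open>1 / w\<close> of all functions collide.\<close>

lemma expectation_collision:
  assumes "finite A" "i \<in> A" "j \<in> A" "i \<noteq> j" "w \<ge> 1"
  shows "measure_pmf.expectation (pmf_of_set (A \<rightarrow>\<^sub>E {1..w})) (\<lambda>h. of_bool (h j = h i)) = 1 / real w"
proof -
  let ?S = "A \<rightarrow>\<^sub>E {1..w}"
  have S: "finite ?S" "?S \<noteq> {}"
    using assms by (auto simp: PiE_eq_empty_iff intro!: finite_PiE)
  have "(\<Sum>h\<in>?S. of_bool (h j = h i) :: real) = (\<Sum>h\<in>{h\<in>?S. h j = h i}. 1)"
    using S by (intro sum.mono_neutral_cong_right) auto
  also have "\<dots> = (\<Sum>h\<in>(A - {j}) \<rightarrow>\<^sub>E {1..w}. 1)"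
    using assms
    by (intro sum.reindex_bij_witness[where i = "\<lambda>h. h(j := h i)" and j = "\<lambda>h. h(j := undefined)"])
       (auto simp: PiE_iff extensional_def fun_eq_iff)
  also have "\<dots> = real w ^ (card A - 1)"
    using assms by (simp add: card_PiE)
  finally have *: "(\<Sum>h\<in>?S. of_bool (h j = h i) :: real) = real w ^ (card A - 1)" .
  have "card A > 0" using assms card_gt_0_iff by blast
  then have "real w ^ card A = real w * real w ^ (card A - 1)"
    by (cases "card A") simp_all
  then show ?thesis
    using S assms * by (simp add: integral_pmf_of_set card_PiE)
qed

lemma finite_row_pmf:
  assumes "w \<ge> 1"
  shows "finite (set_pmf (row_pmf n w))"
  using assms unfolding row_pmf_def
  by (simp add: set_pmf_of_set finite_PiE PiE_eq_empty_iff)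

lemma finite_cs_table_pmf:
  assumes "w \<ge> 1"
  shows "finite (set_pmf (cs_table_pmf n k w))"
  using assms unfolding cs_table_pmf_eq by (intro finite_set_Pi_pmf finite_row_pmf) auto

text \<open>The term of \<open>i\<close> itself contributes exactly \<open>g i\<close>, because
  signs square to 1. In the square of the remaining sum, averaging over the signs removes all cross
  terms, and averaging over the hash function weights each \<open>(g j)\<^sup>2\<close> by the
  collision probability \<open>1 / w\<close>.\<close>

lemma expectation_row_noise_sq:
  assumes "i \<in> {1..n}" "w \<ge> 1"
  shows "measure_pmf.expectation (row_pmf n w) (\<lambda>r. (row_noise n g i r)\<^sup>2) \<le> (\<Sum>j=1..n. (g j)\<^sup>2) / real w"
proof -
  let ?A = "{1..n} - {i}"
  let ?H = "{1..n} \<rightarrow>\<^sub>E {1..w}" and ?S = "{1..n} \<rightarrow>\<^sub>E {-1, 1 :: real}"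
  let ?c = "\<lambda>h :: nat \<Rightarrow> nat. \<lambda>j. of_bool (h j = h i) :: real"
  have fin: "finite ?H" "?H \<noteq> {}" "finite ?S" "?S \<noteq> {}"
    using assms by (auto simp: PiE_eq_empty_iff intro!: finite_PiE)
  have noise: "(row_noise n g i (h, s))\<^sup>2 =
      (\<Sum>j\<in>?A. \<Sum>k\<in>?A. ?c h j * ?c h k * g j * g k * (s j * s k))"
    if "s \<in> ?S" for h s
  proof -
    have s: "s i * s i = 1"
      using that assms by (force simp: PiE_iff)
    have "row_noise n g i (h, s) = s i * (\<Sum>j\<in>?A. ?c h j * s j * g j) + (s i * s i) * g i - g i"
      using assms by (simp add: row_noise_def sum.remove[of _ i] algebra_simps)
    also have "\<dots> = s i * (\<Sum>j\<in>?A. ?c h j * s j * g j)"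
      by (simp add: s)
    finally have "(row_noise n g i (h, s))\<^sup>2 =
        (s i * s i) * ((\<Sum>j\<in>?A. ?c h j * s j * g j) * (\<Sum>k\<in>?A. ?c h k * s k * g k))"
      by (simp add: power2_eq_square mult_ac)
    also have "\<dots> = (\<Sum>j\<in>?A. \<Sum>k\<in>?A. ?c h j * ?c h k * g j * g k * (s j * s k))"
      by (simp add: s sum_product mult_ac)
    finally show ?thesis .
  qed
  have "measure_pmf.expectation (row_pmf n w) (\<lambda>r. (row_noise n g i r)\<^sup>2) =
      measure_pmf.expectation (pmf_of_set ?H) (\<lambda>h. measure_pmf.expectation (pmf_of_set ?S)
        (\<lambda>s. (row_noise n g i (h, s))\<^sup>2))"
    unfolding row_pmf_def using fin by (subst expectation_pair_pmf_finite) auto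
  also have "\<dots> = measure_pmf.expectation (pmf_of_set ?H) (\<lambda>h. \<Sum>j\<in>?A. ?c h j * (g j)\<^sup>2)"
  proof (intro integral_cong_AE AE_pmfI)
    fix h
    have "measure_pmf.expectation (pmf_of_set ?S) (\<lambda>s. (row_noise n g i (h, s))\<^sup>2) =
        measure_pmf.expectation (pmf_of_set ?S)
          (\<lambda>s. \<Sum>j\<in>?A. \<Sum>k\<in>?A. ?c h j * ?c h k * g j * g k * (s j * s k))"
      using noise fin by (intro integral_cong_AE AE_pmfI) (auto simp: set_pmf_of_set)
    also have "\<dots> = (\<Sum>j\<in>?A. \<Sum>k\<in>?A. ?c h j * ?c h k * g j * g k * of_bool (j = k))"
      using fin
      by (simp add: Bochner_Integration.integral_sum integrable_measure_pmf_finite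
          expectation_sign_product)
    also have "\<dots> = (\<Sum>j\<in>?A. ?c h j * (g j)\<^sup>2)"
      by (intro sum.cong refl) (simp add: of_bool_def if_distrib power2_eq_square cong: if_cong)
    finally show "measure_pmf.expectation (pmf_of_set ?S) (\<lambda>s. (row_noise n g i (h, s))\<^sup>2) =
        (\<Sum>j\<in>?A. ?c h j * (g j)\<^sup>2)" .
  qed simp_all
  also have "\<dots> = (\<Sum>j\<in>?A. measure_pmf.expectation (pmf_of_set ?H) (\<lambda>h. ?c h j * (g j)\<^sup>2))"
    using fin by (intro Bochner_Integration.integral_sum integrable_measure_pmf_finite) simp
  also have "\<dots> = (\<Sum>j\<in>?A. 1 / real w * (g j)\<^sup>2)"
    using assms expectation_collision[of "{1..n}" i _ w] by (intro sum.cong) auto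
  \<comment> \<open>Putting coordinate \<open>i\<close> back makes the bound uniform in
    \<open>i\<close>.\<close>
  also have "\<dots> \<le> (\<Sum>j=1..n. 1 / real w * (g j)\<^sup>2)"
    by (intro sum_mono2) auto
  finally show ?thesis
    by (simp add: sum_divide_distrib)
qed

section \<open>Medians under an arbitrary convention\<close>

lemma median_convention_between:
  assumes "median_convention med" "xs \<noteq> []"
  shows "\<exists>u\<in>set xs. u \<le> med xs" "\<exists>v\<in>set xs. med xs \<le> v"
proof -
  have "(length xs - 1) div 2 < length xs" "length xs div 2 < length xs"
    using assms(2) by (cases xs; simp)+
  then have "sort xs ! ((length xs - 1) div 2) \<in> set xs" "sort xs ! (length xs div 2) \<in> set xs"
    by (metis length_sort nth_mem set_sort)+
  then show "\<exists>u\<in>set xs. u \<le> med xs" "\<exists>v\<in>set xs. med xs \<le> v"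
    using assms by (auto simp: median_convention_def)
qed

text \<open>Any convention places the median between two entries, so its distance to
  \<open>a\<close> is at most the larger of their distances. Bounding this maximum by the sum costs
  only a constant factor for four rows and makes linearity of expectation available.\<close>

lemma median_convention_error_le:
  assumes "median_convention med" "xs \<noteq> []"
  shows "\<bar>med xs - a\<bar> \<le> (\<Sum>x\<leftarrow>xs. \<bar>x - a\<bar>)"
proof -
  have le: "\<bar>u - a\<bar> \<le> (\<Sum>x\<leftarrow>xs. \<bar>x - a\<bar>)" if "u \<in> set xs" for u
    using that by (intro member_le_sum_list) auto
  obtain u v where "u \<in> set xs" "u \<le> med xs" "v \<in> set xs" "med xs \<le> v"
    using median_convention_between[OF assms] by blast
  with le[of u] le[of v] show ?thesis by linarith
qed

text \<open>The median is at most the upper middle order statistic. If it reaches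
  \<open>\<tau>\<close>, so do all sorted entries from index \<open>length xs div 2\<close> on,
  which are at least half of the list.\<close>

lemma median_convention_ge_half:
  assumes "median_convention med" "xs \<noteq> []" "\<tau> \<le> med xs"
  shows "length xs \<le> 2 * length (filter (\<lambda>x. \<tau> \<le> x) xs)"
proof -
  let ?m = "length xs div 2"
  have m: "\<tau> \<le> sort xs ! ?m"
    using assms by (force simp: median_convention_def)
  have "{?m..<length xs} \<subseteq> {j. j < length (sort xs) \<and> \<tau> \<le> sort xs ! j}"
  proof safe
    fix j assume j: "j \<in> {?m..<length xs}"
    then show "j < length (sort xs)" by simp
    have "sort xs ! ?m \<le> sort xs ! j"
      using j by (intro sorted_nth_mono) auto
    with m show "\<tau> \<le> sort xs ! j" by simp
  qed
  then have "length xs - ?m \<le> card {j. j < length (sort xs) \<and> \<tau> \<le> sort xs ! j}"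
    using card_mono[of "{j. j < length (sort xs) \<and> \<tau> \<le> sort xs ! j}" "{?m..<length xs}"] by simp
  also have "\<dots> = length (filter (\<lambda>x. \<tau> \<le> x) (sort xs))"
    by (simp add: length_filter_conv_card)
  also have "\<dots> = length (filter (\<lambda>x. \<tau> \<le> x) xs)"
    by (metis filter_sort length_sort)
  finally show ?thesis by linarith
qed

section \<open>Error of CountSketch estimates\<close>

lemma cs_estimate_eq:
  "cs_estimate med n k S g i = med (map (\<lambda>l. row_noise n g i (S l) + g i) [1..<Suc k])"
  by (simp add: cs_estimate_def cs_counter_def row_noise_def case_prod_unfold)

lemma cs_estimate_error_le:
  assumes "median_convention med" "k \<ge> 1"
  shows "\<bar>cs_estimate med n k S g i - g i\<bar> \<le> (\<Sum>l=1..k. \<bar>row_noise n g i (S l)\<bar>)"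
proof -
  have "\<bar>cs_estimate med n k S g i - g i\<bar> \<le>
      (\<Sum>x\<leftarrow>map (\<lambda>l. row_noise n g i (S l) + g i) [1..<Suc k]. \<bar>x - g i\<bar>)"
    unfolding cs_estimate_eq
    using assms by (intro median_convention_error_le) auto
  also have "\<dots> = (\<Sum>l\<leftarrow>[1..<Suc k]. \<bar>row_noise n g i (S l)\<bar>)"
    by (simp add: o_def del: upt_Suc)
  also have "\<dots> = (\<Sum>l=1..k. \<bar>row_noise n g i (S l)\<bar>)"
    by (simp add: sum_list_distinct_conv_sum_set atLeastLessThanSuc_atLeastAtMost del: upt_Suc)
  finally show ?thesis .
qed

text \<open>Absolute noise is bounded by second moments with a free scale \<open>b\<close>. The
  result is linear in the squared norm of \<open>g\<close>, so it can later be averaged over the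
  random fed vector. The scale \<open>b = B\<close> balances the two terms when the squared norm is
  of order \<open>1 / B\<close> and \<open>w\<close> of order \<open>B\<close>.\<close>

lemma expectation_cs_estimate_error_le:
  assumes "median_convention med" "k \<ge> 1" "i \<in> {1..n}" "w \<ge> 1" "b > 0"
  shows "measure_pmf.expectation (cs_table_pmf n k w) (\<lambda>S. \<bar>cs_estimate med n k S g i - g i\<bar>)
    \<le> real k * (b * ((\<Sum>j=1..n. (g j)\<^sup>2) / real w) + 1 / b) / 2"
proof -
  let ?V = "(\<Sum>j=1..n. (g j)\<^sup>2) / real w"
  \<comment> \<open>AM-GM\<close>
  have amgm: "\<bar>y\<bar> \<le> (b * y\<^sup>2 + 1 / b) / 2" for y :: real
  proof -
    have "0 \<le> (b * \<bar>y\<bar> - 1)\<^sup>2 / b" using assms by simp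
    also have "\<dots> = b * y\<^sup>2 - 2 * \<bar>y\<bar> + 1 / b"
      using assms by (simp add: power2_eq_square field_simps)
    finally show ?thesis by simp
  qed
  have "measure_pmf.expectation (cs_table_pmf n k w) (\<lambda>S. \<bar>cs_estimate med n k S g i - g i\<bar>)
      \<le> measure_pmf.expectation (cs_table_pmf n k w)
          (\<lambda>S. \<Sum>l=1..k. (b * (row_noise n g i (S l))\<^sup>2 + 1 / b) / 2)"
    using assms
    by (intro expectation_mono_finite finite_cs_table_pmf
        order.trans[OF cs_estimate_error_le] sum_mono amgm) auto
  also have "\<dots> = (\<Sum>l=1..k. measure_pmf.expectation (cs_table_pmf n k w)
      (\<lambda>S. (b * (row_noise n g i (S l))\<^sup>2 + 1 / b) / 2))"
    using assms by (simp add: integrable_measure_pmf_finite finite_cs_table_pmf del: sum_divide_distrib)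
  also have "\<dots> = (\<Sum>l=1..k. measure_pmf.expectation (row_pmf n w)
      (\<lambda>r. (b * (row_noise n g i r)\<^sup>2 + 1 / b) / 2))"
    unfolding cs_table_pmf_eq
    by (intro sum.cong refl expectation_Pi_pmf_component[where f = "\<lambda>r. (b * (row_noise n g i r)\<^sup>2 + 1 / b) / 2"]) auto
  also have "\<dots> = real k * ((b * measure_pmf.expectation (row_pmf n w) (\<lambda>r. (row_noise n g i r)\<^sup>2) + 1 / b) / 2)"
    using assms by (simp add: integrable_measure_pmf_finite finite_row_pmf)
  also have "\<dots> \<le> real k * ((b * ?V + 1 / b) / 2)"
    using assms
    by (intro mult_left_mono divide_right_mono add_mono expectation_row_noise_sq) auto
  finally show ?thesis by simp
qed

text \<open>If the median of the rows reaches \<open>\<tau>\<close>, some row does, and the noise of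
  that row is at least \<open>\<tau> - g i\<close>. Chebyshev and a union bound over the
  \<open>k\<close> rows give the estimate.\<close>

lemma prob_cs_estimate_ge_le:
  assumes "median_convention med" "k \<ge> 1" "i \<in> {1..n}" "w \<ge> 1" "g i < \<tau>"
  shows "measure_pmf.expectation (cs_table_pmf n k w) (\<lambda>S. of_bool (\<tau> \<le> cs_estimate med n k S g i))
    \<le> real k * ((\<Sum>j=1..n. (g j)\<^sup>2) / real w) / (\<tau> - g i)\<^sup>2"
proof -
  let ?V = "(\<Sum>j=1..n. (g j)\<^sup>2) / real w"
  let ?X = "\<lambda>r. (row_noise n g i r)\<^sup>2 / (\<tau> - g i)\<^sup>2"
  have bound: "of_bool (\<tau> \<le> cs_estimate med n k S g i) \<le> (\<Sum>l=1..k. ?X (S l))" for S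
  proof (cases "\<tau> \<le> cs_estimate med n k S g i")
    case True
    have "\<exists>v\<in>set (map (\<lambda>l. row_noise n g i (S l) + g i) [1..<Suc k]). cs_estimate med n k S g i \<le> v"
      unfolding cs_estimate_eq
      using assms by (intro median_convention_between) auto
    then obtain l where l: "l \<in> {1..k}" "cs_estimate med n k S g i \<le> row_noise n g i (S l) + g i"
      by (fastforce simp del: upt_Suc)
    then have "(\<tau> - g i)\<^sup>2 \<le> (row_noise n g i (S l))\<^sup>2"
      using True assms by (intro power_mono) auto
    then have "1 \<le> ?X (S l)"
      using assms by simp
    also have "\<dots> \<le> (\<Sum>l=1..k. ?X (S l))"
      using l by (intro member_le_sum) auto
    finally show ?thesis using True by simp
  qed (simp add: sum_nonneg)
  have "measure_pmf.expectation (cs_table_pmf n k w) (\<lambda>S. of_bool (\<tau> \<le> cs_estimate med n k S g i))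
      \<le> measure_pmf.expectation (cs_table_pmf n k w) (\<lambda>S. \<Sum>l=1..k. ?X (S l))"
    using assms bound by (intro expectation_mono_finite finite_cs_table_pmf) auto
  also have "\<dots> = (\<Sum>l=1..k. measure_pmf.expectation (cs_table_pmf n k w) (\<lambda>S. ?X (S l)))"
    using assms by (intro Bochner_Integration.integral_sum) (simp add: integrable_measure_pmf_finite finite_cs_table_pmf)
  also have "\<dots> = (\<Sum>l=1..k. measure_pmf.expectation (row_pmf n w) ?X)"
    unfolding cs_table_pmf_eq
    by (intro sum.cong refl expectation_Pi_pmf_component[where f = ?X]) auto
  also have "\<dots> = real k * (measure_pmf.expectation (row_pmf n w) (\<lambda>r. (row_noise n g i r)\<^sup>2) / (\<tau> - g i)\<^sup>2)"
    by simp
  also have "\<dots> \<le> real k * (?V / (\<tau> - g i)\<^sup>2)"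
    using assms
    by (intro mult_left_mono divide_right_mono expectation_row_noise_sq) auto
  finally show ?thesis by simp
qed

text \<open>
  If the median reaches \<open>\<tau>\<close>, then so do at least half of the \<open>m = T - 1\<close> entries, so that
  \<open>64\<close> to the number of such entries is at least \<open>8 ^ m\<close>. Its expectation is at most \<open>2 ^ m\<close>.
\<close>

lemma prob_median_ge_le:
  fixes X :: "'a \<Rightarrow> real"
  assumes med: "median_convention med" and "T \<ge> 2"
    and fin: "\<And>t. t \<in> {1..<T} \<Longrightarrow> finite (set_pmf (q t))"
    and q: "\<And>t. t \<in> {1..<T} \<Longrightarrow> measure_pmf.expectation (q t) (\<lambda>S. of_bool (\<tau> \<le> X S)) \<le> (1 / 64 :: real)"
  shows "measure_pmf.expectation (Pi_pmf {1..<T} d q)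
      (\<lambda>S. of_bool (\<tau> \<le> med (map (\<lambda>t. X (S t)) [1..<T]))) \<le> exp (- (real T - 1))"
proof -
  let ?m = "T - 1"
  let ?f = "\<lambda>S. (if \<tau> \<le> X S then 64 else 1 :: real)"
  have bound: "of_bool (\<tau> \<le> med (map (\<lambda>t. X (S t)) [1..<T])) \<le> (\<Prod>t\<in>{1..<T}. ?f (S t)) / 8 ^ ?m"
    (is "_ \<le> ?r") for S :: "nat \<Rightarrow> 'a"
  proof (cases "\<tau> \<le> med (map (\<lambda>t. X (S t)) [1..<T])")
    case True
    let ?C = "{t\<in>{1..<T}. \<tau> \<le> X (S t)}"
    have "?m \<le> 2 * length (filter (\<lambda>x. \<tau> \<le> x) (map (\<lambda>t. X (S t)) [1..<T]))"
      using median_convention_ge_half[OF med _ True] \<open>T \<ge> 2\<close> by simp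
    also have "length (filter (\<lambda>x. \<tau> \<le> x) (map (\<lambda>t. X (S t)) [1..<T])) = card ?C"
    proof -
      have "length (filter (\<lambda>x. \<tau> \<le> x) (map (\<lambda>t. X (S t)) [1..<T])) =
          card (set (filter (\<lambda>t. \<tau> \<le> X (S t)) [1..<T]))"
        by (simp add: filter_map o_def distinct_card del: set_filter)
      also have "set (filter (\<lambda>t. \<tau> \<le> X (S t)) [1..<T]) = ?C" by (simp only: set_filter set_upt)
      finally show ?thesis .
    qed
    finally have "(8 :: real) ^ ?m \<le> 8 ^ (2 * card ?C)"
      by (intro power_increasing) auto
    also have "\<dots> = (\<Prod>t\<in>{1..<T}. ?f (S t))"
      by (subst prod.inter_filter[symmetric]) (simp_all add: power_mult)
    finally show ?thesis using True by simp
  qed (auto intro!: divide_nonneg_pos prod_nonneg)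
  have fin': "finite (set_pmf (Pi_pmf {1..<T} d q))"
    using fin by (intro finite_set_Pi_pmf) auto
  have e: "exp 1 \<le> (4 :: real)"
    using exp_le by linarith
  have "measure_pmf.expectation (Pi_pmf {1..<T} d q)
      (\<lambda>S. of_bool (\<tau> \<le> med (map (\<lambda>t. X (S t)) [1..<T])))
    \<le> measure_pmf.expectation (Pi_pmf {1..<T} d q) (\<lambda>S. (\<Prod>t\<in>{1..<T}. ?f (S t)) / 8 ^ ?m)"
    by (intro expectation_mono_finite[OF fin'] bound)
  also have "\<dots> = (\<Prod>t\<in>{1..<T}. measure_pmf.expectation (q t) ?f) / 8 ^ ?m"
    using fin
    by (subst expectation_prod_Pi_pmf[where f = "\<lambda>_. ?f", symmetric])
       (auto intro: integrable_measure_pmf_finite)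
  also have "\<dots> \<le> (\<Prod>t\<in>{1..<T}. 2) / 8 ^ ?m"
  proof (intro divide_right_mono prod_mono conjI)
    fix t assume t: "t \<in> {1..<T}"
    show "0 \<le> measure_pmf.expectation (q t) ?f"
      by (intro integral_nonneg_AE AE_pmfI) auto
    \<comment> \<open>The factor is 1, raised by 63 with probability at most \<open>1 / 64\<close>,
      so its mean is below 2.\<close>
    have "measure_pmf.expectation (q t) ?f =
        measure_pmf.expectation (q t) (\<lambda>S. 1 + 63 * of_bool (\<tau> \<le> X S))"
      by (intro Bochner_Integration.integral_cong) auto
    also have "\<dots> = 1 + 63 * measure_pmf.expectation (q t) (\<lambda>S. of_bool (\<tau> \<le> X S))"
      using fin[OF t] by (simp add: integrable_measure_pmf_finite)
    also have "\<dots> \<le> 2"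
      using q[OF t] by simp
    finally show "measure_pmf.expectation (q t) ?f \<le> 2" .
  qed auto
  also have "\<dots> = (1 / 4) ^ ?m"
    by (simp flip: power_divide)
  also have "\<dots> \<le> exp (- 1) ^ ?m"
    using e by (intro power_mono) (auto simp: exp_minus field_simps)
  also have "\<dots> = exp (- (real T - 1))"
    using \<open>T \<ge> 2\<close> by (simp flip: exp_of_nat_mult add: of_nat_diff)
  finally show ?thesis .
qed

text \<open>Independence of the last table from the first \<open>T - 1\<close>: the hypothesis on
  \<open>F\<close> says that \<open>F\<close> ignores table \<open>T\<close>. It is applied with the
  threshold test as \<open>F\<close> and the error of the last table as \<open>G\<close>.\<close>

lemma expectation_tables_split:
  fixes F :: "(nat \<Rightarrow> cs_table) \<Rightarrow> real" and G :: "cs_table \<Rightarrow> real"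
  assumes "T \<ge> 1" "B div (16 * T) \<ge> 1"
    and F: "\<And>S y. F (S(T := y)) = F S"
  shows "measure_pmf.expectation (tables_pmf n B T) (\<lambda>S. F S * G (S T)) =
    measure_pmf.expectation (Pi_pmf {1..<T} undefined (\<lambda>_. cs_table_pmf n 4 (B div (16 * T)))) F *
    measure_pmf.expectation (cs_table_pmf n 4 (B div 16)) G"
proof -
  let ?q = "\<lambda>t. cs_table_pmf n 4 (if t < T then B div (16 * T) else B div 16)"
  have "B div 16 \<ge> 1"
    using assms(2) by (metis div_mult2_eq div_le_dividend le_trans)
  then have fin: "finite (set_pmf (cs_table_pmf n 4 (B div 16)))"
    "finite (set_pmf (Pi_pmf {1..<T} undefined (\<lambda>_. cs_table_pmf n 4 (B div (16 * T)))))"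
    using assms by (auto intro!: finite_cs_table_pmf finite_set_Pi_pmf)
  have "{1..T} = insert T {1..<T}" using assms by auto
  then have "tables_pmf n B T = Pi_pmf (insert T {1..<T}) undefined ?q"
    by (simp add: tables_pmf_def)
  also have "\<dots> = map_pmf (\<lambda>(y, f). f(T := y)) (pair_pmf (?q T) (Pi_pmf {1..<T} undefined ?q))"
    by (intro Pi_pmf_insert) auto
  also have "Pi_pmf {1..<T} undefined ?q =
      Pi_pmf {1..<T} undefined (\<lambda>_. cs_table_pmf n 4 (B div (16 * T)))"
    by (intro Pi_pmf_cong) auto
  finally show ?thesis
    using fin by (simp add: case_prod_unfold F expectation_pair_pmf_finite mult.commute fun_upd_same del: fun_upd_apply)
qed

subsection \<open>Error and query bounds\<close>

lemma real_div_ge_half: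
  fixes a b :: nat
  assumes "b div a \<ge> 1"
  shows "real b \<le> 2 * real a * real (b div a)"
proof -
  have "a > 0" using assms by (cases a) auto
  then have "b mod a < a" by simp
  also have "a \<le> a * (b div a)" using assms by simp
  finally have "b \<le> 2 * a * (b div a)"
    using mult_div_mod_eq[of a b] by linarith
  then have "real b \<le> real (2 * a * (b div a))"
    by (rule of_nat_mono)
  then show ?thesis by simp
qed

lemma sum_inverse_squares_le:
  assumes "m \<ge> 1"
  shows "(\<Sum>j=m..n. 1 / (real j)\<^sup>2) \<le> 2 / real m"
proof (cases "m \<le> n")
  case True
  \<comment> \<open>The term \<open>- 1 / real n\<close> strengthens the claim so that the induction
    telescopes.\<close>
  then have "(\<Sum>j=m..n. 1 / (real j)\<^sup>2) \<le> 2 / real m - 1 / real n"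
  proof (induction n rule: dec_induct)
    case base
    have "1 / (real m)\<^sup>2 \<le> 1 / real m"
      using assms by (intro divide_left_mono) (auto simp: power2_eq_square)
    then show ?case by simp
  next
    case (step n)
    have n: "real n > 0" using step assms by simp
    have "1 / (real (Suc n))\<^sup>2 \<le> 1 / (real n * real (Suc n))"
      using n by (intro divide_left_mono) (auto simp: power2_eq_square)
    also have "\<dots> = 1 / real n - 1 / real (Suc n)"
      using n by (simp add: field_simps)
    finally show ?case
      using step by simp
  qed
  moreover have "1 / real n \<ge> 0" by simp
  ultimately show ?thesis by linarith
qed (use assms in auto)

lemma sum_light_squares_le:
  assumes "B \<ge> 1"
  shows "(\<Sum>j\<in>{j\<in>{1..n}. 2 * j > B}. 1 / (real j)\<^sup>2) \<le> 4 / real B"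
proof -
  \<comment> \<open>The least \<open>j\<close> with \<open>2 * j > B\<close>, for either parity of
    \<open>B\<close>.\<close>
  let ?m = "B div 2 + 1"
  have "(\<Sum>j\<in>{j\<in>{1..n}. 2 * j > B}. 1 / (real j)\<^sup>2) = (\<Sum>j=?m..n. 1 / (real j)\<^sup>2)"
    by (intro sum.cong) auto
  also have "\<dots> \<le> 2 / real ?m"
    by (intro sum_inverse_squares_le) simp
  also have "\<dots> \<le> 2 / (real B / 2)"
  proof (intro divide_left_mono)
    have "B \<le> 2 * ?m" by simp
    then have "real B \<le> real (2 * ?m)" by (rule of_nat_mono)
    then show "real B / 2 \<le> real ?m" by simp
  qed (use assms in auto)
  finally show ?thesis by simp
qed

lemma sum_reciprocals_bounds:
  assumes "n \<ge> 1"
  shows "ln (real n) \<le> (\<Sum>i=1..n. 1 / real i)" "(\<Sum>i=1..n. 1 / real i) \<le> ln (real n) + 1"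
proof -
  have "ln (real n) \<le> ln (real n + 1)"
    using assms by simp
  also have "\<dots> \<le> (\<Sum>i=1..n. 1 / real i)"
    using ln_le_harm[of n] by (simp add: harm_def inverse_eq_divide)
  finally show "ln (real n) \<le> (\<Sum>i=1..n. 1 / real i)" .
  show "(\<Sum>i=1..n. 1 / real i) \<le> ln (real n) + 1"
    using assms
  proof (induction n rule: nat_induct_at_least)
    case (Suc n)
    \<comment> \<open>The tangent bound for \<open>ln\<close> at 1 compares one harmonic term with
      one increment of the logarithm.\<close>
    have "ln (real n / real (Suc n)) \<le> real n / real (Suc n) - 1"
      using Suc by (intro ln_le_minus_one) auto
    also have "\<dots> = - (1 / real (Suc n))"
      by (simp add: field_simps)
    finally have "1 / real (Suc n) \<le> ln (real (Suc n)) - ln (real n)"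
      using Suc by (simp add: ln_div)
    then show ?case using Suc by simp
  qed simp
qed

lemma freq_Cons: "freq (u # us) i = (if fst u = i then snd u else 0) + freq us i"
  by (simp add: freq_def case_prod_unfold)

lemma sum_list_updates_eq:
  assumes "\<And>u. u \<in> set \<sigma> \<Longrightarrow> fst u \<in> {1..n}"
  shows "(\<Sum>u\<leftarrow>\<sigma>. snd u) = (\<Sum>i=1..n. freq \<sigma> i)"
  using assms
proof (induction \<sigma>)
  case (Cons u us)
  have "fst u \<in> {1..n}" using Cons.prems by simp
  then show ?case
    using Cons by (simp add: freq_Cons sum.distrib)
qed (simp add: freq_def)

section \<open>Error of an answer for a fixed fed vector\<close>

definition passes_threshold ::
    "(real list \<Rightarrow> real) \<Rightarrow> nat \<Rightarrow> nat \<Rightarrow> real \<Rightarrow> (nat \<Rightarrow> cs_table) \<Rightarrow> (nat \<Rightarrow> real) \<Rightarrow> nat \<Rightarrow> bool" where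
  "passes_threshold med n T \<tau> S g i \<longleftrightarrow>
     \<tau> \<le> med (map (\<lambda>t. cs_estimate med n 4 (S t) g i) [1..<T])"

text \<open>Only the tables are averaged here. They are independent of the sampling, so the fed
  vector can be held fixed as \<open>g\<close> and averaged afterwards.\<close>

definition expected_false_error ::
    "(real list \<Rightarrow> real) \<Rightarrow> nat \<Rightarrow> nat \<Rightarrow> nat \<Rightarrow> real \<Rightarrow> (nat \<Rightarrow> real) \<Rightarrow> nat \<Rightarrow> real" where
  "expected_false_error med n B T \<tau> g i =
     measure_pmf.expectation (tables_pmf n B T)
       (\<lambda>S. of_bool (passes_threshold med n T \<tau> S g i) * \<bar>cs_estimate med n 4 (S T) g i - g i\<bar>)"

text \<open>A classified item errs by exactly \<open>fed st i\<close>. For an unclassified one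
  \<open>fed st i\<close> is its frequency, which is also the error of the answer 0. If the
  threshold is passed, the error is that of the last table.\<close>

lemma answer_error_le:
  assumes "st \<in> set_pmf (process_stream \<gamma> n B orc \<sigma> init_state)"
    and "\<And>u. u \<in> set \<sigma> \<Longrightarrow> snd u > 0"
  shows "\<bar>freq \<sigma> i - answer med n T \<tau> (st, S) i\<bar> \<le> fed st i + of_bool (exact st i = None) *
     (of_bool (passes_threshold med n T \<tau> S (fed st) i) * \<bar>cs_estimate med n 4 (S T) (fed st) i - fed st i\<bar>)"
  using final_state_cases[OF assms, where x = i]
  by (cases "exact st i") (auto simp: answer_def passes_threshold_def)

context
  fixes med :: "real list \<Rightarrow> real" and n B T :: nat and \<tau> :: real
  assumes med: "median_convention med" and T: "T \<ge> 2" and cols: "B div (16 * T) \<ge> 1"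
begin

lemma columns: "B div 16 \<ge> 1" "B \<ge> 1"
proof -
  show "B div 16 \<ge> 1"
    using cols by (metis div_mult2_eq div_le_dividend le_trans)
  then show "B \<ge> 1" by (cases B) auto
qed

lemma finite_tables_pmf: "finite (set_pmf (tables_pmf n B T))"
  unfolding tables_pmf_def
  using cols columns by (intro finite_set_Pi_pmf finite_cs_table_pmf) auto

lemma expected_false_error_eq:
  "expected_false_error med n B T \<tau> g i =
    measure_pmf.expectation (Pi_pmf {1..<T} undefined (\<lambda>_. cs_table_pmf n 4 (B div (16 * T))))
      (\<lambda>S. of_bool (\<tau> \<le> med (map (\<lambda>t. cs_estimate med n 4 (S t) g i) [1..<T]))) *
    measure_pmf.expectation (cs_table_pmf n 4 (B div 16)) (\<lambda>S. \<bar>cs_estimate med n 4 S g i - g i\<bar>)"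
proof -
  have eq: "map (\<lambda>t. cs_estimate med n 4 ((S(T := y)) t) g i) [1..<T] =
      map (\<lambda>t. cs_estimate med n 4 (S t) g i) [1..<T]" for S y
    by (intro map_cong) auto
  show ?thesis
    unfolding expected_false_error_def passes_threshold_def
  proof (rule expectation_tables_split)
    show "T \<ge> 1" using T by simp
  qed (use cols in \<open>simp_all only: eq\<close>)
qed

lemma expectation_last_table_error_le:
  assumes "i \<in> {1..n}"
  shows "measure_pmf.expectation (cs_table_pmf n 4 (B div 16)) (\<lambda>S. \<bar>cs_estimate med n 4 S g i - g i\<bar>)
    \<le> 64 * (\<Sum>j=1..n. (g j)\<^sup>2) + 2 / real B"
proof -
  let ?V = "\<Sum>j=1..n. (g j)\<^sup>2"
  have B: "real B > 0" using columns by simp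
  have w: "real (B div 16) > 0" using columns by linarith
  \<comment> \<open>Rounding the number of columns down loses at most a factor 2, hence
    \<open>32 = 2 * 16\<close>.\<close>
  have "real B / real (B div 16) \<le> 32"
    using real_div_ge_half[of B 16] columns w by (simp add: divide_le_eq)
  then have "real B / real (B div 16) * ?V \<le> 32 * ?V"
    by (intro mult_right_mono sum_nonneg) auto
  then show ?thesis
    using expectation_cs_estimate_error_le[OF med _ assms columns(1) B, where k = 4 and g = g]
    by simp
qed

lemma expected_false_error_le:
  assumes "i \<in> {1..n}"
  shows "expected_false_error med n B T \<tau> g i \<le> 64 * (\<Sum>j=1..n. (g j)\<^sup>2) + 2 / real B"
proof -
  let ?P = "Pi_pmf {1..<T} undefined (\<lambda>_. cs_table_pmf n 4 (B div (16 * T)))"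
  have "measure_pmf.expectation ?P
      (\<lambda>S. of_bool (\<tau> \<le> med (map (\<lambda>t. cs_estimate med n 4 (S t) g i) [1..<T]))) \<le> (1 :: real)"
    using cols by (intro expectation_le_const_finite finite_set_Pi_pmf finite_cs_table_pmf) auto
  then have "expected_false_error med n B T \<tau> g i \<le>
      1 * measure_pmf.expectation (cs_table_pmf n 4 (B div 16)) (\<lambda>S. \<bar>cs_estimate med n 4 S g i - g i\<bar>)"
    unfolding expected_false_error_eq by (intro mult_right_mono integral_nonneg_AE) auto
  also have "\<dots> \<le> 64 * (\<Sum>j=1..n. (g j)\<^sup>2) + 2 / real B"
    using expectation_last_table_error_le[OF assms] by simp
  finally show ?thesis .
qed

text \<open>A light item has to overcome a gap of \<open>\<tau> / 2\<close> in the tables that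
  decide the threshold, which makes passing improbable. The error of the independent last table then
  enters only through the product of the two expectations.\<close>

lemma expected_false_error_light_le:
  assumes i: "i \<in> {1..n}" and \<tau>: "\<tau> > 0" "g i \<le> \<tau> / 2"
    and V: "(\<Sum>j=1..n. (g j)\<^sup>2) \<le> 5 / real B"
    and small: "163840 * real T \<le> (real B * \<tau>)\<^sup>2"
  shows "expected_false_error med n B T \<tau> g i \<le> exp (- (real T - 1)) * (322 / real B)"
proof -
  let ?P = "Pi_pmf {1..<T} undefined (\<lambda>_. cs_table_pmf n 4 (B div (16 * T)))"
  let ?w = "B div (16 * T)"
  have B: "real B > 0" using columns by simp
  have w: "real ?w > 0" using cols by linarith
  have "1 / real ?w \<le> 32 * real T / real B"
    using real_div_ge_half[OF cols] w B by (simp add: field_simps)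
  then have "(\<Sum>j=1..n. (g j)\<^sup>2) * (1 / real ?w) \<le> 5 / real B * (32 * real T / real B)"
    using V by (intro mult_mono sum_nonneg) auto
  then have Vw: "(\<Sum>j=1..n. (g j)\<^sup>2) / real ?w \<le> 160 * real T / (real B)\<^sup>2"
    by (simp add: power2_eq_square)
  have "measure_pmf.expectation (cs_table_pmf n 4 ?w) (\<lambda>S. of_bool (\<tau> \<le> cs_estimate med n 4 S g i))
      \<le> real 4 * ((\<Sum>j=1..n. (g j)\<^sup>2) / real ?w) / (\<tau> - g i)\<^sup>2"
    using med i cols \<tau> by (intro prob_cs_estimate_ge_le) auto
  also have "\<dots> \<le> real 4 * (160 * real T / (real B)\<^sup>2) / (\<tau> / 2)\<^sup>2"
  proof (rule frac_le)
    show "(\<tau> / 2)\<^sup>2 \<le> (\<tau> - g i)\<^sup>2"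
      using \<tau> by (intro power_mono) auto
  qed (use Vw \<tau> in auto)
  \<comment> \<open>The constant is \<open>64 * 4 * 4 * 160\<close>: the target probability
    \<open>1 / 64\<close>, four rows, the halved gap squared, and \<open>160 = 5 * 32\<close> from
    the norm and the column count.\<close>
  also have "\<dots> = (163840 * real T) / (64 * (real B * \<tau>)\<^sup>2)"
    using B \<tau> by (simp add: field_simps)
  also have "\<dots> \<le> (real B * \<tau>)\<^sup>2 / (64 * (real B * \<tau>)\<^sup>2)"
    using small by (intro divide_right_mono) auto
  also have "\<dots> = 1 / 64"
    using B \<tau> by simp
  finally have "measure_pmf.expectation ?P
      (\<lambda>S. of_bool (\<tau> \<le> med (map (\<lambda>t. cs_estimate med n 4 (S t) g i) [1..<T]))) \<le> exp (- (real T - 1))"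
    using cols by (intro prob_median_ge_le[OF med T] finite_cs_table_pmf) auto
  \<comment> \<open>Here \<open>322 = 64 * 5 + 2\<close>.\<close>
  moreover have "measure_pmf.expectation (cs_table_pmf n 4 (B div 16))
      (\<lambda>S. \<bar>cs_estimate med n 4 S g i - g i\<bar>) \<le> 322 / real B"
    using expectation_last_table_error_le[OF i, of g] V by simp
  ultimately show ?thesis
    unfolding expected_false_error_eq by (intro mult_mono integral_nonneg_AE) auto
qed

section \<open>Averaging over the sampling of oracle queries\<close>

context
  fixes \<gamma> :: real and \<sigma> :: "(nat \<times> real) list" and orc :: "nat \<Rightarrow> bool"
    and P :: "alg_state pmf" and L :: real
  assumes \<gamma>: "\<gamma> \<ge> 1" and L: "L = ln (real n)" "L \<ge> 2" "L \<le> real B"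
    and stream: "zipf_stream n \<sigma>" and orc: "correct_oracle n B orc"
    and \<tau>_ge: "4 / real B \<le> \<tau>" and small: "163840 * real T \<le> (real B * \<tau>)\<^sup>2"
    and T_ge: "exp (- (real T - 1)) \<le> 1 / L"
  defines "P \<equiv> process_stream \<gamma> n B orc \<sigma> init_state"
begin

lemma update_pos: "u \<in> set \<sigma> \<Longrightarrow> snd u > 0"
  using stream by (auto simp: zipf_stream_def)

lemma freq_zipf: "i \<in> {1..n} \<Longrightarrow> freq \<sigma> i = 1 / real i"
  using stream by (auto simp: zipf_stream_def)

lemma orc_iff: "i \<in> {1..n} \<Longrightarrow> orc i \<longleftrightarrow> 2 * i \<le> B"
  using orc by (auto simp: correct_oracle_def)

lemma B_pos: "real B \<ge> 2"
  using L by simp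

lemma query_rate_ge: "real B * L\<^sup>2 \<le> query_rate \<gamma> n B"
proof -
  have "1 * (real B * L\<^sup>2) \<le> \<gamma> * (real B * L\<^sup>2)"
    using \<gamma> by (intro mult_right_mono) auto
  then show ?thesis
    by (simp add: query_rate_def L(1) mult.assoc)
qed

lemma query_rate_pos: "query_rate \<gamma> n B > 0"
proof -
  have "0 < real B * L\<^sup>2" using B_pos L by simp
  with query_rate_ge show ?thesis by linarith
qed

lemma inverse_query_rate_le: "1 / query_rate \<gamma> n B \<le> 1 / (real B * L)"
proof (rule divide_left_mono)
  have "real B * L \<le> real B * L\<^sup>2"
    using L B_pos by (intro mult_left_mono) (auto simp: power2_eq_square)
  then show "real B * L \<le> query_rate \<gamma> n B"
    using query_rate_ge by linarith
  show "0 < query_rate \<gamma> n B * (real B * L)"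
    using query_rate_pos B_pos L by simp
qed simp

lemma finite_P: "finite (set_pmf P)"
  unfolding P_def by (rule finite_process_stream)

lemma final_state:
  assumes "st \<in> set_pmf P"
  shows "0 \<le> fed st x" "fed st x \<le> freq \<sigma> x"
    and "exact st x = None \<Longrightarrow> fed st x = freq \<sigma> x"
    and "exact st x = Some c \<Longrightarrow> orc x"
  using final_state_cases[OF assms[unfolded P_def]] update_pos by blast+

lemma sum_fed_sq_le_2:
  assumes "st \<in> set_pmf P"
  shows "(\<Sum>j=1..n. (fed st j)\<^sup>2) \<le> 2"
proof -
  have "(\<Sum>j=1..n. (fed st j)\<^sup>2) \<le> (\<Sum>j=1..n. 1 / (real j)\<^sup>2)"
  proof (rule sum_mono)
    fix j assume "j \<in> {1..n}"
    then have "(fed st j)\<^sup>2 \<le> (1 / real j)\<^sup>2"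
      using final_state(1,2)[OF assms, of j] by (intro power_mono) (auto simp: freq_zipf)
    then show "(fed st j)\<^sup>2 \<le> 1 / (real j)\<^sup>2" by (simp add: power_divide)
  qed
  then show ?thesis
    using sum_inverse_squares_le[of 1 n] by simp
qed

text \<open>The random part of the squared norm of the fed vector. The part of the light items is
  bounded deterministically.\<close>

definition heavy_residual :: "alg_state \<Rightarrow> real" where
  "heavy_residual st = (\<Sum>j\<in>{j\<in>{1..n}. 2 * j \<le> B}. (fed st j)\<^sup>2)"

lemma sum_fed_sq_le:
  assumes "st \<in> set_pmf P"
  shows "(\<Sum>j=1..n. (fed st j)\<^sup>2) \<le> 4 / real B + heavy_residual st"
proof -
  have "(\<Sum>j=1..n. (fed st j)\<^sup>2) =
      (\<Sum>j\<in>{j\<in>{1..n}. 2 * j > B} \<union> {j\<in>{1..n}. 2 * j \<le> B}. (fed st j)\<^sup>2)"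
    by (intro sum.cong) auto
  also have "\<dots> = (\<Sum>j\<in>{j\<in>{1..n}. 2 * j > B}. (fed st j)\<^sup>2) + heavy_residual st"
    unfolding heavy_residual_def by (intro sum.union_disjoint) auto
  also have "(\<Sum>j\<in>{j\<in>{1..n}. 2 * j > B}. (fed st j)\<^sup>2) \<le> (\<Sum>j\<in>{j\<in>{1..n}. 2 * j > B}. 1 / (real j)\<^sup>2)"
  proof (rule sum_mono)
    fix j assume "j \<in> {j\<in>{1..n}. 2 * j > B}"
    then have "(fed st j)\<^sup>2 \<le> (1 / real j)\<^sup>2"
      using final_state(1,2)[OF assms, of j] by (intro power_mono) (auto simp: freq_zipf)
    then show "(fed st j)\<^sup>2 \<le> 1 / (real j)\<^sup>2" by (simp add: power_divide)
  qed
  also have "\<dots> \<le> 4 / real B"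
    using columns by (intro sum_light_squares_le)
  finally show ?thesis by simp
qed

lemma expectation_heavy_residual_le:
  "measure_pmf.expectation P heavy_residual \<le> 1 / (real B * L)"
proof -
  let ?J = "{j\<in>{1..n}. 2 * j \<le> B}" and ?q = "query_rate \<gamma> n B"
  have "measure_pmf.expectation P heavy_residual =
      (\<Sum>j\<in>?J. measure_pmf.expectation P (\<lambda>st. (fed st j)\<^sup>2))"
    unfolding heavy_residual_def
    by (intro Bochner_Integration.integral_sum integrable_measure_pmf_finite finite_P)
  also have "\<dots> \<le> (\<Sum>j\<in>?J. 2 / ?q\<^sup>2)"
    unfolding P_def using \<gamma> query_rate_pos update_pos
    by (intro sum_mono expectation_fed_sq_le) (auto simp: orc_iff)
  also have "\<dots> = real (card ?J) * (2 / ?q\<^sup>2)" by simp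
  \<comment> \<open>At most \<open>B / 2\<close> heavy items contribute, each with second moment at
    most \<open>2 / ?q\<^sup>2\<close>.\<close>
  also have "\<dots> \<le> real B / 2 * (2 / ?q\<^sup>2)"
  proof (rule mult_right_mono)
    have "?J \<subseteq> {1..B div 2}" by auto
    then have "card ?J \<le> B div 2"
      using card_mono[of "{1..B div 2}" ?J] by simp
    then show "real (card ?J) \<le> real B / 2" by linarith
  qed simp
  also have "\<dots> = real B * (1 / ?q) * (1 / ?q)"
    by (simp add: power2_eq_square)
  also have "\<dots> \<le> real B * (1 / (real B * L)) * (1 / (real B * L))"
    using inverse_query_rate_le query_rate_pos L
    by (intro mult_mono) auto
  also have "\<dots> = 1 / L * (1 / (real B * L))"
    using B_pos by simp
  also have "\<dots> \<le> 1 * (1 / (real B * L))"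
    using L by (intro mult_right_mono) auto
  finally show ?thesis by simp
qed

text \<open>The exponent \<open>query_rate \<gamma> n B / i\<close> has to dominate
  \<open>ln (B * L)\<close>. Since \<open>B\<close> may be far larger than \<open>n\<close>,
  \<open>ln B\<close> is not controlled by \<open>L\<close> alone. Writing \<open>B = i * x\<close>
  gives \<open>ln B \<le> L + x\<close>, while the exponent is at least
  \<open>L\<^sup>2 * x\<close>, and both \<open>L\<close> and \<open>x\<close> are at least
  2.\<close>

lemma prob_unclassified_heavy_le:
  assumes i: "i \<in> {1..n}" "2 * i \<le> B"
  shows "measure_pmf.expectation P (\<lambda>st. of_bool (exact st i = None)) \<le> 1 / (real B * L)"
proof -
  define x where "x = real B / real i"
  have ipos: "real i > 0" using i by simp
  have x: "x \<ge> 2"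
  proof -
    have "real (2 * i) \<le> real B" using i(2) by (rule of_nat_mono)
    then show ?thesis using ipos by (simp add: x_def field_simps)
  qed
  have "ln (real B) = ln (real i) + ln x"
    using ipos B_pos by (simp add: x_def ln_div)
  also have "ln (real i) \<le> L" using i by (simp add: L(1))
  also have "ln x \<le> x" using x ln_le_minus_one[of x] by simp
  finally have "ln (real B) + ln L \<le> 2 * L + x"
    using ln_le_minus_one[of L] L by simp
  also have "\<dots> \<le> L * x + L * x"
    using L(2) x mult_mono[of 2 L 2 x] mult_left_mono[of 2 x L] mult_right_mono[of 2 L x] by linarith
  also have "\<dots> = 2 * (L * x)" by simp
  also have "\<dots> \<le> L * (L * x)" using L x by (intro mult_right_mono) auto
  also have "\<dots> = real B * L\<^sup>2 * (1 / real i)" by (simp add: x_def power2_eq_square)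
  also have "\<dots> \<le> query_rate \<gamma> n B * freq \<sigma> i"
    using query_rate_ge i by (simp add: freq_zipf divide_right_mono)
  finally have "exp (- query_rate \<gamma> n B * freq \<sigma> i) \<le> exp (- (ln (real B) + ln L))"
    by simp
  also have "\<dots> = 1 / (real B * L)"
    using B_pos L(2) by (subst exp_minus) (simp add: exp_add inverse_eq_divide)
  finally show ?thesis
    using prob_unclassified_le[of \<gamma> n B \<sigma> orc i] \<gamma> query_rate_pos update_pos i
    unfolding P_def by (auto simp: orc_iff)
qed

lemma expectation_answer_error_le_false:
  "measure_pmf.expectation (alg_pmf \<gamma> n B T orc \<sigma>) (\<lambda>\<omega>. \<bar>freq \<sigma> i - answer med n T \<tau> \<omega> i\<bar>)
    \<le> measure_pmf.expectation P (\<lambda>st. fed st i +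
         of_bool (exact st i = None) * expected_false_error med n B T \<tau> (fed st) i)"
proof -
  have "measure_pmf.expectation (alg_pmf \<gamma> n B T orc \<sigma>) (\<lambda>\<omega>. \<bar>freq \<sigma> i - answer med n T \<tau> \<omega> i\<bar>) =
      measure_pmf.expectation P (\<lambda>st. measure_pmf.expectation (tables_pmf n B T)
        (\<lambda>S. \<bar>freq \<sigma> i - answer med n T \<tau> (st, S) i\<bar>))"
    unfolding alg_pmf_def P_def[symmetric]
    by (rule expectation_pair_pmf_finite[OF finite_P finite_tables_pmf])
  also have "\<dots> \<le> measure_pmf.expectation P (\<lambda>st. fed st i +
      of_bool (exact st i = None) * expected_false_error med n B T \<tau> (fed st) i)"
  proof (rule expectation_mono_finite[OF finite_P])
    fix st assume "st \<in> set_pmf P"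
    then have "measure_pmf.expectation (tables_pmf n B T)
          (\<lambda>S. \<bar>freq \<sigma> i - answer med n T \<tau> (st, S) i\<bar>) \<le>
        measure_pmf.expectation (tables_pmf n B T) (\<lambda>S. fed st i + of_bool (exact st i = None) *
          (of_bool (passes_threshold med n T \<tau> S (fed st) i) * \<bar>cs_estimate med n 4 (S T) (fed st) i - fed st i\<bar>))"
      using update_pos unfolding P_def
      by (intro expectation_mono_finite finite_tables_pmf answer_error_le)
    also have "\<dots> = fed st i + of_bool (exact st i = None) * expected_false_error med n B T \<tau> (fed st) i"
      unfolding expected_false_error_def
      by (simp add: integrable_measure_pmf_finite finite_tables_pmf del: sum_of_bool_mult_eq)
    finally show "measure_pmf.expectation (tables_pmf n B T)
          (\<lambda>S. \<bar>freq \<sigma> i - answer med n T \<tau> (st, S) i\<bar>) \<le>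
        fed st i + of_bool (exact st i = None) * expected_false_error med n B T \<tau> (fed st) i" .
  qed
  finally show ?thesis .
qed

text \<open>A heavy item pays for the mass fed before classification and, with small probability, a
  constant for remaining unclassified. A light item pays its frequency, which covers the answer 0,
  plus the error after wrongly passing the threshold.\<close>

lemma expectation_answer_error_le:
  assumes i: "i \<in> {1..n}"
  shows "measure_pmf.expectation (alg_pmf \<gamma> n B T orc \<sigma>) (\<lambda>\<omega>. \<bar>freq \<sigma> i - answer med n T \<tau> \<omega> i\<bar>)
    \<le> 650 / (real B * L) + (if 2 * i > B then 1 / real i else 0)"
proof (cases "2 * i \<le> B")
  case True
  have "measure_pmf.expectation P (\<lambda>st. fed st i +
      of_bool (exact st i = None) * expected_false_error med n B T \<tau> (fed st) i) \<le>
    measure_pmf.expectation P (\<lambda>st. fed st i + of_bool (exact st i = None) * 130)"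
  proof (intro expectation_mono_finite[OF finite_P] add_left_mono mult_left_mono)
    fix st assume "st \<in> set_pmf P"
    \<comment> \<open>The squared norm is at most 2 in every outcome, so the error is at most
      \<open>64 * 2 + 1\<close>.\<close>
    have "2 / real B \<le> 1" using B_pos by simp
    then show "expected_false_error med n B T \<tau> (fed st) i \<le> 130"
      using expected_false_error_le[OF i, of "fed st"] sum_fed_sq_le_2[OF \<open>st \<in> set_pmf P\<close>] by linarith
  qed auto
  also have "\<dots> = measure_pmf.expectation P (\<lambda>st. fed st i) +
      measure_pmf.expectation P (\<lambda>st. of_bool (exact st i = None)) * 130"
    using finite_P by (simp add: integrable_measure_pmf_finite)
  also have "\<dots> \<le> 1 / (real B * L) + 1 / (real B * L) * 130"
  proof (intro add_mono mult_right_mono prob_unclassified_heavy_le i True)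
    have "measure_pmf.expectation P (\<lambda>st. fed st i) \<le> 1 / query_rate \<gamma> n B"
      unfolding P_def using \<gamma> query_rate_pos update_pos i True
      by (intro expectation_fed_le) (auto simp: orc_iff)
    then show "measure_pmf.expectation P (\<lambda>st. fed st i) \<le> 1 / (real B * L)"
      using inverse_query_rate_le by linarith
  qed simp
  also have "\<dots> \<le> 650 / (real B * L)"
    using L by (simp add: divide_right_mono flip: add_divide_distrib)
  finally show ?thesis
    using expectation_answer_error_le_false[of i] True by simp
next
  case False
  have "real B < real (2 * i)" using False by (intro of_nat_less_iff[THEN iffD2]) simp
  then have i_light: "1 / real i \<le> 2 / real B"
    using B_pos by (simp add: field_simps)
  have "measure_pmf.expectation P (\<lambda>st. fed st i +
      of_bool (exact st i = None) * expected_false_error med n B T \<tau> (fed st) i) \<le>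
    measure_pmf.expectation P (\<lambda>st. 1 / real i + (322 / (real B * L) + 322 * heavy_residual st))"
  proof (rule expectation_mono_finite[OF finite_P])
    fix st assume st: "st \<in> set_pmf P"
    have none: "exact st i = None"
      using final_state(4)[OF st, of i] False i orc_iff[of i] by (cases "exact st i") auto
    then have fed: "fed st i = 1 / real i"
      using final_state(3)[OF st, of i] i by (simp add: freq_zipf)
    have nonneg: "0 \<le> heavy_residual st"
      unfolding heavy_residual_def by (intro sum_nonneg) auto
    \<comment> \<open>A residual of at most \<open>1 / B\<close> gives squared norm at most
      \<open>5 / B\<close>, and the threshold filters at rate \<open>1 / L\<close>. A larger
      residual dominates every \<open>1 / B\<close>: the norm is at most 5 residuals, and
      \<open>64 * 5 + 2 = 322\<close>.\<close>
    have "expected_false_error med n B T \<tau> (fed st) i \<le> 322 / (real B * L) + 322 * heavy_residual st"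
    proof (cases "heavy_residual st \<le> 1 / real B")
      case True
      have "\<tau> > 0" using \<tau>_ge B_pos by (smt (verit) divide_pos_pos)
      then have "expected_false_error med n B T \<tau> (fed st) i \<le> exp (- (real T - 1)) * (322 / real B)"
        using i \<tau>_ge i_light small True sum_fed_sq_le[OF st] fed
        by (intro expected_false_error_light_le) auto
      also have "\<dots> \<le> 1 / L * (322 / real B)"
        using T_ge by (intro mult_right_mono) auto
      finally show ?thesis using nonneg by (simp add: mult.commute)
    next
      case False
      have "expected_false_error med n B T \<tau> (fed st) i \<le> 322 * heavy_residual st"
        using expected_false_error_le[OF i, of "fed st"] sum_fed_sq_le[OF st] False by simp
      moreover have "0 \<le> 322 / (real B * L)" using L by simp
      ultimately show ?thesis by linarith
    qed
    then show "fed st i + of_bool (exact st i = None) * expected_false_error med n B T \<tau> (fed st) i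
        \<le> 1 / real i + (322 / (real B * L) + 322 * heavy_residual st)"
      by (simp add: none fed)
  qed
  also have "\<dots> = 1 / real i + (322 / (real B * L) + 322 * measure_pmf.expectation P heavy_residual)"
    using finite_P by (simp add: integrable_measure_pmf_finite)
  also have "\<dots> \<le> 1 / real i + (322 / (real B * L) + 322 * (1 / (real B * L)))"
    by (intro add_left_mono mult_left_mono expectation_heavy_residual_le) simp
  also have "\<dots> \<le> 1 / real i + 650 / (real B * L)"
    using L by (simp add: divide_right_mono flip: add_divide_distrib)
  finally show ?thesis
    using expectation_answer_error_le_false[of i] False by simp
qed

text \<open>The uniform part of the error survives the weighted average unchanged. The light
  frequencies add \<open>(4 / B) / N\<close> with \<open>N \<ge> L\<close>, whence
  \<open>654 = 650 + 4\<close>.\<close>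

lemma expectation_weighted_error_le:
  "measure_pmf.expectation (alg_pmf \<gamma> n B T orc \<sigma>)
     (\<lambda>\<omega>. weighted_error n (freq \<sigma>) (answer med n T \<tau> \<omega>)) \<le> 654 / (real B * L)"
proof -
  let ?A = "alg_pmf \<gamma> n B T orc \<sigma>" and ?N = "\<Sum>i=1..n. 1 / real i"
  have n: "n \<ge> 1" using L by (cases n) auto
  have N: "L \<le> ?N" "?N > 0"
    using sum_reciprocals_bounds[OF n] L by auto
  have finA: "finite (set_pmf ?A)"
    unfolding alg_pmf_def P_def[symmetric] using finite_P finite_tables_pmf by simp
  have "measure_pmf.expectation ?A (\<lambda>\<omega>. weighted_error n (freq \<sigma>) (answer med n T \<tau> \<omega>)) =
      1 / ?N * (\<Sum>i=1..n. 1 / real i * measure_pmf.expectation ?A (\<lambda>\<omega>. \<bar>freq \<sigma> i - answer med n T \<tau> \<omega> i\<bar>))"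
    unfolding weighted_error_def
    using finA by (simp add: integrable_measure_pmf_finite freq_zipf)
  also have "\<dots> \<le> 1 / ?N * (\<Sum>i=1..n. 1 / real i * (650 / (real B * L) + (if 2 * i > B then 1 / real i else 0)))"
    using N(2) by (intro mult_left_mono sum_mono expectation_answer_error_le) auto
  also have "(\<Sum>i=1..n. 1 / real i * (650 / (real B * L) + (if 2 * i > B then 1 / real i else 0))) =
      ?N * (650 / (real B * L)) + (\<Sum>i=1..n. if 2 * i > B then 1 / (real i)\<^sup>2 else 0)"
    unfolding sum_distrib_right sum.distrib[symmetric]
    by (intro sum.cong) (auto simp: distrib_left power2_eq_square)
  also have "(\<Sum>i=1..n. if 2 * i > B then 1 / (real i)\<^sup>2 else 0) =
      (\<Sum>i\<in>{i\<in>{1..n}. 2 * i > B}. 1 / (real i)\<^sup>2)"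
    by (simp only: sum.inter_filter finite_atLeastAtMost)
  also have "1 / ?N * (?N * (650 / (real B * L)) + \<dots>) \<le> 1 / ?N * (?N * (650 / (real B * L)) + 4 / real B)"
    using N(2) columns by (intro mult_left_mono add_left_mono sum_light_squares_le) auto
  also have "\<dots> = 650 / (real B * L) + 4 / real B * (1 / ?N)"
    using N(2) by (simp add: distrib_left)
  also have "\<dots> \<le> 650 / (real B * L) + 4 / real B * (1 / L)"
    using N L by (intro add_left_mono mult_left_mono divide_left_mono) auto
  also have "\<dots> = 654 / (real B * L)"
    using L B_pos by (simp add: field_simps)
  finally show ?thesis .
qed

lemma expectation_alg_queries_le:
  "measure_pmf.expectation (alg_pmf \<gamma> n B T orc \<sigma>) (\<lambda>\<omega>. real (queries (fst \<omega>)))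
    \<le> 2 * \<gamma> * real B * L ^ 3"
proof -
  have n: "n \<ge> 1" using L by (cases n) auto
  have "measure_pmf.expectation (alg_pmf \<gamma> n B T orc \<sigma>) (\<lambda>\<omega>. real (queries (fst \<omega>))) =
      measure_pmf.expectation P (\<lambda>st. real (queries st))"
    unfolding alg_pmf_def P_def[symmetric]
    by (simp add: expectation_pair_pmf_finite[OF finite_P finite_tables_pmf])
  also have "\<dots> \<le> query_rate \<gamma> n B * (\<Sum>u\<leftarrow>\<sigma>. snd u)"
    unfolding P_def using \<gamma> query_rate_pos update_pos by (intro expectation_queries_le) auto
  also have "(\<Sum>u\<leftarrow>\<sigma>. snd u) = (\<Sum>i=1..n. freq \<sigma> i)"
    using stream by (intro sum_list_updates_eq) (auto simp: zipf_stream_def)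
  also have "\<dots> = (\<Sum>i=1..n. 1 / real i)"
    by (intro sum.cong refl freq_zipf)
  also have "query_rate \<gamma> n B * \<dots> \<le> query_rate \<gamma> n B * (2 * L)"
    using sum_reciprocals_bounds[OF n] L query_rate_pos by (intro mult_left_mono) auto
  also have "\<dots> = 2 * \<gamma> * real B * L ^ 3"
    by (simp add: query_rate_def L(1) power2_eq_square power3_eq_cube)
  finally show ?thesis .
qed

end
end

section \<open>Choice of the constants\<close>

lemma half_exp_square_le:
  fixes x :: real
  assumes "x \<ge> 0"
  shows "x\<^sup>2 / 2 \<le> exp x"
  using exp_lower_Taylor_quadratic[OF assms] assms by simp

theorem theorem18:
  "\<exists>c\<^sub>T c\<^sub>\<tau> \<gamma>\<^sub>0 :: real. c\<^sub>T > 0 \<and> c\<^sub>\<tau> > 0 \<and> \<gamma>\<^sub>0 > 0 \<and>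
     (\<forall>\<gamma>\<ge>\<gamma>\<^sub>0. \<exists>(K :: real) (n\<^sub>0 :: nat). \<forall>n\<ge>n\<^sub>0. \<forall>B :: nat. \<forall>\<sigma> oracle med.
        ln (real n) \<le> real B \<longrightarrow> zipf_stream n \<sigma> \<longrightarrow> correct_oracle n B oracle \<longrightarrow>
        median_convention med \<longrightarrow>
        (let T = nat \<lceil>c\<^sub>T * ln (ln (real n))\<rceil>;
             \<tau> = c\<^sub>\<tau> * ln (ln (real n)) / real B;
             P = alg_pmf \<gamma> n B T oracle \<sigma>
         in measure_pmf.expectation P
              (\<lambda>\<omega>. weighted_error n (freq \<sigma>) (answer med n T \<tau> \<omega>)) \<le> K / (real B * ln (real n)) \<and>
            measure_pmf.expectation P (\<lambda>\<omega>. real (queries (fst \<omega>))) \<le> K * real B * (ln (real n)) ^ 3))"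
proof (intro exI conjI allI impI)
  \<comment> \<open>The witnesses are \<open>c\<^sub>T = 2\<close>,
    \<open>c\<^sub>\<tau> = 1\<close>, \<open>\<gamma>\<^sub>0 = 1\<close> and
    \<open>K = max 654 (2 * \<gamma>)\<close>. The choice of \<open>n\<^sub>0\<close> forces
    \<open>ln (ln n) \<ge> 500000\<close>.\<close>
  fix \<gamma> :: real and n B :: nat and \<sigma> orc med
  assume \<gamma>: "\<gamma> \<ge> 1" and n: "n \<ge> nat \<lceil>exp (exp 500000) :: real\<rceil>"
    and B: "ln (real n) \<le> real B"
    and hyps: "zipf_stream n \<sigma>" "correct_oracle n B orc" "median_convention med"
  define L where "L = ln (real n)"
  define l where "l = ln L"
  define T where "T = nat \<lceil>2 * l\<rceil>"
  define \<tau> where "\<tau> = 1 * l / real B"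
  have "exp (exp 500000) \<le> real n"
    using n by (simp add: nat_ceiling_le_eq)
  then have "exp 500000 \<le> L"
    unfolding L_def using ln_ge_iff less_le_trans[OF exp_gt_zero] by blast
  then have l: "500000 \<le> l" and expl: "exp l = L"
    unfolding l_def using ln_ge_iff less_le_trans[OF exp_gt_zero] by (blast, simp)
  have Tl: "2 * l \<le> real T" "real T \<le> 3 * l"
    using l unfolding T_def by linarith+
  have L96: "96 * l \<le> L"
  proof -
    have "96 * l \<le> l / 2 * l" using l by (intro mult_right_mono) auto
    also have "\<dots> \<le> L" using half_exp_square_le[of l] l expl by (simp add: power2_eq_square)
    finally show ?thesis .
  qed
  have L2: "L \<ge> 2" using L96 l by linarith
  have Bpos: "real B > 0" using L2 B by (simp add: L_def)
  \<comment> \<open>Since \<open>16 * T \<le> 48 * l \<le> L \<le> B\<close>, each of the narrow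
    tables has at least one column.\<close>
  have "real (16 * T) \<le> real B"
    using Tl L96 B l by (simp add: L_def)
  then have "16 * T \<le> B" using of_nat_le_iff by blast
  then have cols: "B div (16 * T) \<ge> 1"
    using Tl l by (simp add: div_greater_zero_iff Suc_le_eq)
  have T2: "T \<ge> 2" using Tl l by linarith
  \<comment> \<open>From \<open>T \<ge> 2 * l\<close> and \<open>l \<ge> 1\<close> follows
    \<open>T - 1 \<ge> l\<close>; this is where \<open>c\<^sub>T = 2\<close> enters.\<close>
  have "exp (- (real T - 1)) \<le> exp (- l)"
    using Tl l by simp
  then have T_ge: "exp (- (real T - 1)) \<le> 1 / L"
    by (simp add: exp_minus expl inverse_eq_divide)
  have \<tau>_ge: "4 / real B \<le> \<tau>"
    using l by (simp add: \<tau>_def divide_right_mono)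
  \<comment> \<open>With \<open>T \<le> 3 * l\<close> the left side is at most
    \<open>491520 * l\<close>. As \<open>B * \<tau> = l\<close>, the condition then follows from
    \<open>l \<ge> 500000\<close>.\<close>
  have "163840 * real T \<le> 500000 * l" using Tl l by linarith
  also have "\<dots> \<le> l * l" using l by (intro mult_right_mono) auto
  finally have small: "163840 * real T \<le> (real B * \<tau>)\<^sup>2"
    using Bpos by (simp add: \<tau>_def power2_eq_square)
  note setting = hyps(3) T2 cols \<gamma> L_def L2 B[folded L_def] hyps(1,2) \<tau>_ge small T_ge
  have "measure_pmf.expectation (alg_pmf \<gamma> n B T orc \<sigma>)
      (\<lambda>\<omega>. weighted_error n (freq \<sigma>) (answer med n T \<tau> \<omega>)) \<le> 654 / (real B * L)"
    by (rule expectation_weighted_error_le[OF setting])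
  also have "\<dots> \<le> max 654 (2 * \<gamma>) / (real B * L)"
    using Bpos L2 by (intro divide_right_mono) auto
  finally have error: "measure_pmf.expectation (alg_pmf \<gamma> n B T orc \<sigma>)
      (\<lambda>\<omega>. weighted_error n (freq \<sigma>) (answer med n T \<tau> \<omega>)) \<le> max 654 (2 * \<gamma>) / (real B * L)" .
  have "measure_pmf.expectation (alg_pmf \<gamma> n B T orc \<sigma>) (\<lambda>\<omega>. real (queries (fst \<omega>)))
      \<le> 2 * \<gamma> * real B * L ^ 3"
    by (rule expectation_alg_queries_le[OF setting])
  also have "\<dots> \<le> max 654 (2 * \<gamma>) * real B * L ^ 3"
    using L2 by (intro mult_right_mono) auto
  finally have queries: "measure_pmf.expectation (alg_pmf \<gamma> n B T orc \<sigma>) (\<lambda>\<omega>. real (queries (fst \<omega>)))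
      \<le> max 654 (2 * \<gamma>) * real B * L ^ 3" .
  show "let T = nat \<lceil>2 * ln (ln (real n))\<rceil>; \<tau> = 1 * ln (ln (real n)) / real B;
          P = alg_pmf \<gamma> n B T orc \<sigma>
        in measure_pmf.expectation P
             (\<lambda>\<omega>. weighted_error n (freq \<sigma>) (answer med n T \<tau> \<omega>)) \<le> max 654 (2 * \<gamma>) / (real B * ln (real n)) \<and>
           measure_pmf.expectation P (\<lambda>\<omega>. real (queries (fst \<omega>))) \<le> max 654 (2 * \<gamma>) * real B * (ln (real n)) ^ 3"
    using error queries by (simp only: Let_def T_def \<tau>_def l_def L_def)
qed auto

end
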